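(* Let $\alpha\in\mathbb{R}$ be fixed with $\alpha>-1$, and let $L_n^{(\alpha)}$ denote the associated Laguerre polynomial of degree $n\in\mathbb{N}_0$ with parameter $\alpha$. For $x\in(0,\infty)$, $$\lim_{N\to\infty}\sqrt{N}\sum_{n=N+1}^\infty\frac{\Gamma(n)\left(L_n^{(\alpha)}(x)\right)^2}{\Gamma(n+\alpha+1)}=\frac{x^{-\alpha-\frac12}e^x}{\pi},$$ and, for $x,y\in(0,\infty)$ with $x\neq y$ and for all $\gamma<\frac12$, $$\lim_{N\to\infty}N^\gamma\sum_{n=N+1}^\infty\frac{\Gamma(n)L_n^{(\alpha)}(x)L_n^{(\alpha)}(y)}{\Gamma(n+\alpha+1)}=0.$$
   Context: For $\alpha>-1$, the associated Laguerre polynomials $\{L_n^{(\alpha)}:n\in\mathbb{N}_0\}$ are the polynomials, with $L_n^{(\alpha)}$ of degree $n$, which are orthogonal on $[0,\infty)$ with respect to the weight $x^\alpha e^{-x}$ and normalised so that $\int_0^\infty x^\alpha e^{-x}(L_n^{(\alpha)}(x))^2\,\mathrm{d}x=\Gamma(n+\alpha+1)/n!$ and the leading coefficient of $L_n^{(\alpha)}$ is $(-1)^n/n!$. The superscript $(\alpha)$ is a parameter, not a derivative. *)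

theory Defs
  imports "HOL-Analysis.Analysis" "HOL-Computational_Algebra.Polynomial"
begin

text \<open>
  The four conditions determine \<open>L\<close> uniquely when \<open>\<alpha> > - 1\<close>.  The integrands are then
  absolutely integrable, so the integrals below are genuine; the convention
  \<open>0 powr \<alpha> = 0\<close> only affects the integrands at the single point \<open>0\<close>.
\<close>

definition assoc_laguerre_polys :: "real \<Rightarrow> (nat \<Rightarrow> real poly) \<Rightarrow> bool" where
  "assoc_laguerre_polys \<alpha> L \<longleftrightarrow>
     (\<forall>n. degree (L n) = n) \<and>
     (\<forall>m n. m \<noteq> n \<longrightarrow>
        (LBINT x:{0..}. x powr \<alpha> * exp (- x) * (poly (L m) x * poly (L n) x)) = 0) \<and>
     (\<forall>n. (LBINT x:{0..}. x powr \<alpha> * exp (- x) * (poly (L n) x)\<^sup>2)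
            = Gamma (real n + \<alpha> + 1) / fact n) \<and>
     (\<forall>n. lead_coeff (L n) = (- 1) ^ n / fact n)"

text \<open>The \<open>n\<close>-th term of the series; only \<open>n \<ge> 1\<close> is meaningful, as \<open>Gamma\<close> has a pole at \<open>0\<close>.\<close>

definition laguerre_term ::
  "real \<Rightarrow> (nat \<Rightarrow> real poly) \<Rightarrow> real \<Rightarrow> real \<Rightarrow> nat \<Rightarrow> real" where
  "laguerre_term \<alpha> L x y n =
     Gamma (real n) * poly (L n) x * poly (L n) y / Gamma (real n + \<alpha> + 1)"

end

theory Submission
  imports Defs "HOL-Complex_Analysis.Complex_Analysis" "HOL-Real_Asymp.Real_Asymp"
    "HOL-Probability.Sinc_Integral"
begin

text \<open>
  On the diagonal every term is nonnegative, so the tail can be found by a Tauberian theorem, and the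
  oscillation of \<open>L\<^sub>n(x)\<close> in \<open>n\<close>, which a pointwise (Fejer) asymptotic formula would have to
  describe, never enters: it is averaged out by a contour integral.

  The polynomials satisfy a three-term recurrence, and the recurrence is the differential equation
  \<open>(1 - t)\<^sup>2 H'(t) = ((\<alpha> + 1) (1 - t) - x) H(t)\<close> read off coefficient by coefficient.  Hence
  \<open>H(t) = (1 - t)\<^bsup>-\<alpha>-1\<^esup> exp (- x t / (1 - t))\<close> generates \<open>L\<^sub>n(x)\<close> and \<open>t H'(t)\<close> generates
  \<open>n L\<^sub>n(x)\<close> (\<open>laguerre_gf_deriv_sums\<close>).  Parseval's identity on the circle of radius
  \<open>r = exp (- s / 2)\<close> turns \<open>\<Sum>n. (n L\<^sub>n(x))\<^sup>2 exp (- s n)\<close> into the mean of \<open>|t H'(t)|\<^sup>2\<close>,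
  an explicit function of \<open>|1 - t|\<^sup>2\<close> and \<open>r\<close> times a factor that tends to \<open>x\<^sup>2\<close> as \<open>t\<close> tends to 1.  As \<open>s\<close> tends to \<open>0\<close> the
  mass of the integral sits at angles of order \<open>sqrt s\<close>; after rescaling, dominated convergence
  leaves a Gamma integral, and the sum behaves like a constant times \<open>s\<^bsup>-\<alpha>-5/2\<^esup>\<close>
  (\<open>laguerre_abel_asymptotics\<close>).  The factor \<open>n\<^sup>2\<close> is there to make the exponent positive, and the
  rescaled integral convergent, for all \<open>\<alpha> > -1\<close> at once; with \<open>L\<^sub>n(x)\<^sup>2\<close> alone both would fail for
  \<open>\<alpha> \<le> -1/2\<close>.

  Karamata's theorem (\<open>karamata_tauberian\<close>) converts this into the growth of the partial sums of
  \<open>(n L\<^sub>n(x))\<^sup>2\<close>, and summation by parts (\<open>regular_tail_of_partial_sums\<close>) into the tail with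
  weights \<open>n\<^bsup>-\<alpha>-3\<^esup>\<close>, to which \<open>\<Gamma>(n) / (n\<^sup>2 \<Gamma>(n + \<alpha> + 1))\<close> is asymptotically equal.

  Off the diagonal \<open>2 |L\<^sub>n(x) L\<^sub>n(y)| \<le> L\<^sub>n(x)\<^sup>2 + L\<^sub>n(y)\<^sup>2\<close> bounds the tail by a multiple of
  \<open>1 / sqrt N\<close>, which is already enough for every \<open>\<gamma> < 1/2\<close>.
\<close>

section \<open>Tails of series with regularly growing partial sums\<close>

text \<open>
  Factors that converge may be replaced by their limit inside a nonnegative tail: from some index on
  they are within \<open>\<epsilon>\<close> of \<open>l\<close>, and the error is then at most \<open>\<epsilon>\<close> times the tail.  The sign
  condition starts at 1, the first index that a tail meets.
\<close>

lemma tail_tendsto_weighted: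
  fixes c v g :: "nat \<Rightarrow> real"
  assumes v: "\<And>n. n \<ge> 1 \<Longrightarrow> v n \<ge> 0" and sv: "summable v"
    and g: "\<And>N. g N \<ge> 0"
    and c: "c \<longlonglongrightarrow> l"
    and T: "(\<lambda>N. g N * (\<Sum>k. v (N + 1 + k))) \<longlonglongrightarrow> V"
  shows "summable (\<lambda>n. c n * v n)"
    and "(\<lambda>N. g N * (\<Sum>k. c (N + 1 + k) * v (N + 1 + k))) \<longlonglongrightarrow> l * V"
proof -
  have sv': "summable (\<lambda>k. v (N + 1 + k))" for N
    using sv summable_iff_shift[of v "N+1"] by (simp add: add.commute)
  have "Bseq c" using c by (meson convergentI Bseq_conv_Bfun convergent_imp_Bseq)
  then obtain K where K: "\<And>n. norm (c n) \<le> K" by (auto simp: Bseq_def)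
  have "summable (\<lambda>k. c (1 + k) * v (1 + k))"
  proof (rule summable_comparison_test')
    show "summable (\<lambda>k. K * v (1 + k))" using sv'[of 0] by (simp add: summable_mult)
    show "norm (c (1 + k) * v (1 + k)) \<le> K * v (1 + k)" for k
      using K[of "1+k"] v[of "1+k"] by (simp add: abs_mult mult_right_mono)
  qed
  then show s: "summable (\<lambda>n. c n * v n)"
    using summable_iff_shift[of "\<lambda>n. c n * v n" 1] by simp
  have s': "summable (\<lambda>k. c (N + 1 + k) * v (N + 1 + k))" for N
    using s summable_iff_shift[of "\<lambda>n. c n * v n" "N+1"] by (simp add: add.commute)
  define d where "d N = g N * (\<Sum>k. c (N + 1 + k) * v (N + 1 + k)) - l * (g N * (\<Sum>k. v (N + 1 + k)))" for N
  have "d \<longlonglongrightarrow> 0"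
  proof (rule LIMSEQ_I)
    fix e :: real assume e: "e > 0"
    define W where "W = \<bar>V\<bar> + 1"
    have W: "W > 0" unfolding W_def using abs_ge_zero[of V] by linarith
    define e' where "e' = e / (2 * W)"
    have e': "e' > 0" using e W by (simp add: e'_def)
    obtain N0 where N0: "\<And>n. n \<ge> N0 \<Longrightarrow> \<bar>c n - l\<bar> < e'"
      using LIMSEQ_D[OF c e'] by auto
    obtain N1 where N1: "\<And>n. n \<ge> N1 \<Longrightarrow> \<bar>g n * (\<Sum>k. v (n + 1 + k)) - V\<bar> < 1"
      using LIMSEQ_D[OF T, of 1] by auto
    show "\<exists>no. \<forall>n\<ge>no. norm (d n - 0) < e"
    proof (intro exI allI impI)
      fix N assume N: "N \<ge> max N0 N1"
      have "d N = g N * (\<Sum>k. (c (N + 1 + k) - l) * v (N + 1 + k))"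
        unfolding d_def left_diff_distrib
        using suminf_diff[OF s'[of N] summable_mult[OF sv'[of N], of l]] suminf_mult[OF sv'[of N], of l]
        by (simp add: algebra_simps)
      moreover have "\<bar>\<Sum>k. (c (N + 1 + k) - l) * v (N + 1 + k)\<bar> \<le> (\<Sum>k. e' * v (N + 1 + k))"
      proof (rule norm_suminf_le[where 'a=real, unfolded real_norm_def])
        show "summable (\<lambda>k. e' * v (N + 1 + k))" using sv' by (intro summable_mult)
        show "\<bar>(c (N + 1 + k) - l) * v (N + 1 + k)\<bar> \<le> e' * v (N + 1 + k)" for k
          using N0[of "N+1+k"] N v[of "N+1+k"] by (simp add: abs_mult mult_right_mono)
      qed
      ultimately have "\<bar>d N\<bar> \<le> g N * (e' * (\<Sum>k. v (N + 1 + k)))"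
        using g[of N] suminf_mult[OF sv'[of N], of e'] by (simp add: abs_mult mult_left_mono)
      also have "\<dots> = e' * (g N * (\<Sum>k. v (N + 1 + k)))" by simp
      also have "\<dots> \<le> e' * W"
        using N1[of N] N e' by (intro mult_left_mono) (auto simp: W_def)
      also have "\<dots> = e / 2" using W by (simp add: e'_def)
      finally show "norm (d N - 0) < e" using e by simp
    qed
  qed
  then have "(\<lambda>N. d N + l * (g N * (\<Sum>k. v (N + 1 + k)))) \<longlonglongrightarrow> 0 + l * V"
    by (intro tendsto_add tendsto_mult T tendsto_const)
  then show "(\<lambda>N. g N * (\<Sum>k. c (N + 1 + k) * v (N + 1 + k))) \<longlonglongrightarrow> l * V"
    by (simp add: d_def)
qed

text \<open>
  Summation by parts.  With \<open>S\<close> the partial sums of \<open>a\<close>, the tail of \<open>n\<^bsup>-\<sigma>\<^esup> a n\<close> is the tail of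
  \<open>S n (n\<^bsup>-\<sigma>\<^esup> - (n + 1)\<^bsup>-\<sigma>\<^esup>)\<close> minus a boundary term.  The former is compared with the telescoping
  differences \<open>v n\<close> of \<open>n\<^bsup>\<rho>-\<sigma>\<^esup>\<close>, whose tails are exact; the quotient of the two summands tends to
  \<open>A \<sigma> / (\<sigma> - \<rho>)\<close>, and the boundary term contributes \<open>- A\<close>.
\<close>

lemma regular_tail_of_partial_sums:
  fixes a :: "nat \<Rightarrow> real"
  assumes a: "\<And>n. a n \<ge> 0" and \<rho>: "0 < \<rho>" "\<rho> < \<sigma>"
    and S: "(\<lambda>N. (\<Sum>n\<le>N. a n) / real N powr \<rho>) \<longlonglongrightarrow> A"
  shows "summable (\<lambda>n. real n powr - \<sigma> * a n)"
    and "(\<lambda>N. real N powr (\<sigma> - \<rho>) * (\<Sum>k. real (N + 1 + k) powr - \<sigma> * a (N + 1 + k)))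
           \<longlonglongrightarrow> A * \<rho> / (\<sigma> - \<rho>)"
proof -
  define S where "S N = (\<Sum>n\<le>N. a n)" for N
  define f where "f n = S n * real (n + 1) powr - \<sigma>" for n
  define v where "v n = real n powr (\<rho> - \<sigma>) - real (n + 1) powr (\<rho> - \<sigma>)" for n
  define u where "u n = S n * (real n powr - \<sigma> - real (n + 1) powr - \<sigma>)" for n
  define c where "c n = u n / v n" for n
  have Slim: "(\<lambda>N. S N / real N powr \<rho>) \<longlonglongrightarrow> A" using S by (simp add: S_def)
  have vpos: "v n > 0" if "n \<ge> 1" for n
    unfolding v_def using that \<rho> by (simp add: powr_less_mono2_neg)
  have f0: "f \<longlonglongrightarrow> 0"
  proof -
    have "(\<lambda>n. (S n / real n powr \<rho>) * (real n powr \<rho> * real (n + 1) powr - \<sigma>)) \<longlonglongrightarrow> A * 0"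
      using \<rho> by (intro tendsto_mult Slim) real_asymp
    moreover have "eventually (\<lambda>n. (S n / real n powr \<rho>) * (real n powr \<rho> * real (n + 1) powr - \<sigma>) = f n) sequentially"
      using eventually_gt_at_top[of 0] by eventually_elim (simp add: f_def)
    ultimately show ?thesis by (simp add: tendsto_cong)
  qed
  have vs: "(\<lambda>k. v (N + 1 + k)) sums (real (N + 1) powr (\<rho> - \<sigma>))" for N
  proof -
    define h where "h k = real (N + 1 + k) powr (\<rho> - \<sigma>)" for k
    have "h \<longlonglongrightarrow> 0" unfolding h_def using \<rho> by real_asymp
    from telescope_sums'[OF this] show ?thesis
      by (simp add: h_def v_def algebra_simps)
  qed
  have sv: "summable v"
    using vs[of 0] summable_iff_shift[of v 1] by (auto simp: sums_iff)
  have clim: "c \<longlonglongrightarrow> A * (\<sigma> / (\<sigma> - \<rho>))"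
  proof -
    have "(\<lambda>n. (S n / real n powr \<rho>) * (real n powr \<rho> * (real n powr - \<sigma> - real (n + 1) powr - \<sigma>) / v n))
       \<longlonglongrightarrow> A * (\<sigma> / (\<sigma> - \<rho>))"
      unfolding v_def using \<rho> by (intro tendsto_mult Slim, real_asymp) (simp add: divide_inverse)
    moreover have "eventually (\<lambda>n. (S n / real n powr \<rho>) * (real n powr \<rho> * (real n powr - \<sigma> - real (n + 1) powr - \<sigma>) / v n) = c n) sequentially"
      using eventually_gt_at_top[of 0] by eventually_elim (simp add: c_def u_def)
    ultimately show ?thesis by (simp add: tendsto_cong)
  qed
  have Tv: "(\<lambda>N. real N powr (\<sigma> - \<rho>) * (\<Sum>k. v (N + 1 + k))) \<longlonglongrightarrow> 1"
    unfolding vs[THEN sums_unique, symmetric] using \<rho> by real_asymp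
  have cu: "c (N + 1 + k) * v (N + 1 + k) = u (N + 1 + k)" for N k
    using vpos[of "N+1+k"] by (simp add: c_def)
  note W = tail_tendsto_weighted[OF less_imp_le[OF vpos] sv powr_ge_zero clim Tv, unfolded cu]
  have su: "summable (\<lambda>k. u (N + 1 + k))" for N
  proof -
    have "summable (\<lambda>k. c (k + (N + 1)) * v (k + (N + 1)))"
      using W(1) by (subst summable_iff_shift)
    then show ?thesis
      by (simp only: add.commute[of _ "N + 1"] cu)
  qed
  have as: "(\<lambda>k. real (N + 1 + k) powr - \<sigma> * a (N + 1 + k)) sums ((\<Sum>k. u (N + 1 + k)) - f N)" for N
  proof -
    have "(\<lambda>k. f (N + k)) \<longlonglongrightarrow> 0"
      using f0 by (subst add.commute) (rule LIMSEQ_ignore_initial_segment)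
    from sums_add[OF telescope_sums[OF this] summable_sums[OF su[of N]]]
    have "(\<lambda>k. f (N + Suc k) - f (N + k) + u (N + 1 + k)) sums ((\<Sum>k. u (N + 1 + k)) - f N)"
      by simp
    moreover have "f (N + Suc k) - f (N + k) + u (N + 1 + k) = real (N + 1 + k) powr - \<sigma> * a (N + 1 + k)" for k
      by (simp add: f_def u_def S_def algebra_simps)
    ultimately show ?thesis by simp
  qed
  show "summable (\<lambda>n. real n powr - \<sigma> * a n)"
    using as[of 0] summable_iff_shift[of "\<lambda>n. real n powr - \<sigma> * a n" 1] by (auto simp: sums_iff)
  have fl: "(\<lambda>N. real N powr (\<sigma> - \<rho>) * f N) \<longlonglongrightarrow> A"
  proof -
    have "(\<lambda>n. (S n / real n powr \<rho>) * (real n powr \<sigma> * real (n + 1) powr - \<sigma>)) \<longlonglongrightarrow> A * 1"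
      using \<rho> by (intro tendsto_mult Slim) real_asymp
    moreover have "eventually (\<lambda>n. (S n / real n powr \<rho>) * (real n powr \<sigma> * real (n + 1) powr - \<sigma>) = real n powr (\<sigma> - \<rho>) * f n) sequentially"
      using eventually_gt_at_top[of 0] by eventually_elim (simp add: f_def powr_diff)
    ultimately show ?thesis by (simp add: tendsto_cong)
  qed
  have "(\<lambda>N. real N powr (\<sigma> - \<rho>) * (\<Sum>k. u (N + 1 + k)) - real N powr (\<sigma> - \<rho>) * f N)
     \<longlonglongrightarrow> A * (\<sigma> / (\<sigma> - \<rho>)) * 1 - A"
    by (intro tendsto_diff fl W(2))
  moreover have "A * (\<sigma> / (\<sigma> - \<rho>)) * 1 - A = A * \<rho> / (\<sigma> - \<rho>)"
    using \<rho> by (simp add: field_simps)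
  ultimately show "(\<lambda>N. real N powr (\<sigma> - \<rho>) * (\<Sum>k. real (N + 1 + k) powr - \<sigma> * a (N + 1 + k)))
           \<longlonglongrightarrow> A * \<rho> / (\<sigma> - \<rho>)"
    unfolding as[THEN sums_unique, symmetric] by (simp add: right_diff_distrib)
qed

section \<open>Karamata's Tauberian theorem\<close>

text \<open>
  Euler's integral for \<open>\<Gamma>\<close> after a change of variables: stated for any domain and any bijection onto
  the half-line, because it is used for a dilation and for \<open>x / \<phi>\<^sup>2\<close> on each half-line.
\<close>

lemma Gamma_integral_substitution:
  fixes g g' :: "real \<Rightarrow> real"
  assumes \<rho>: "\<rho> > 0" and S: "S \<in> sets lebesgue" and g: "bij_betw g S {0<..}"
    and der: "\<And>u. u \<in> S \<Longrightarrow> (g has_field_derivative g' u) (at u)"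
  shows "((\<lambda>u. \<bar>g' u\<bar> * (g u powr (\<rho> - 1) * exp (- g u))) has_integral Gamma \<rho>) S"
proof -
  let ?f = "\<lambda>u::real. u powr (\<rho> - 1) * exp (- u)"
  have "(?f has_integral Gamma \<rho>) {0..}"
    using Gamma_integral_real[OF \<rho>] by (simp add: exp_minus divide_inverse)
  then have "(?f has_integral Gamma \<rho>) {0<..}"
    by (rule iffD1[OF has_integral_spike_set_eq, rotated 2])
       (auto intro: negligible_subset[OF negligible_sing[of 0]])
  then have int: "integral {0<..} ?f = Gamma \<rho>" and "?f integrable_on {0<..}"
    by (auto simp: integral_unique has_integral_integrable)
  then have abs: "?f absolutely_integrable_on {0<..}"
    by (intro nonnegative_absolutely_integrable_1) auto
  have "(\<lambda>u. \<bar>g' u\<bar> * ?f (g u)) absolutely_integrable_on S \<and>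
        integral S (\<lambda>u. \<bar>g' u\<bar> * ?f (g u)) = Gamma \<rho>
     \<longleftrightarrow> ?f absolutely_integrable_on g ` S \<and> integral (g ` S) ?f = Gamma \<rho>"
    using g der S by (intro has_absolute_integral_change_of_variables_1')
      (auto simp: bij_betw_def intro: has_field_derivative_at_within)
  with abs int g have "(\<lambda>u. \<bar>g' u\<bar> * ?f (g u)) absolutely_integrable_on S"
    and I: "integral S (\<lambda>u. \<bar>g' u\<bar> * ?f (g u)) = Gamma \<rho>"
    by (auto simp: bij_betw_def)
  then have "(\<lambda>u. \<bar>g' u\<bar> * ?f (g u)) integrable_on S"
    by (intro set_lebesgue_integral_eq_integral(1))
  then show ?thesis unfolding has_integral_iff using I by blast
qed

lemma has_integral_powr_exp:
  fixes \<rho> c :: real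
  assumes "\<rho> > 0" "c > 0"
  shows "((\<lambda>u. u powr (\<rho> - 1) * exp (- (c * u))) has_integral Gamma \<rho> * c powr - \<rho>) {0<..}"
proof -
  have bij: "bij_betw (\<lambda>u. c * u) {0<..} {0<..}"
    using assms by (intro bij_betwI[of _ _ _ "\<lambda>u. u / c"]) auto
  have "((\<lambda>u. \<bar>c\<bar> * ((c * u) powr (\<rho> - 1) * exp (- (c * u)))) has_integral Gamma \<rho>) {0<..}"
    by (rule Gamma_integral_substitution[OF assms(1) _ bij]) (auto intro!: derivative_eq_intros)
  then have "((\<lambda>u. c powr - \<rho> * (\<bar>c\<bar> * ((c * u) powr (\<rho> - 1) * exp (- (c * u))))) has_integral c powr - \<rho> * Gamma \<rho>) {0<..}"
    by (rule has_integral_mult_right)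
  then show ?thesis
    using assms
    by (elim has_integral_eq_rhs[OF has_integral_eq, rotated])
       (auto simp: powr_mult powr_diff powr_minus field_simps)
qed

text \<open>
  A sharp cutoff in \<open>u\<close> jumps, so it is not a uniform limit of polynomials in \<open>exp (- u)\<close>.  It lies between
  two continuous ramps, however, and the ramp that falls from 1 at \<open>a\<close> to 0 at \<open>b\<close>, divided by
  \<open>exp (- u)\<close>, is a continuous function of \<open>v = exp (- u)\<close> on the compact interval from 0 to 1 to which
  Weierstrass's theorem applies.
\<close>

lemma exp_cutoff_approx:
  fixes a b e :: real
  assumes "0 < a" "a < b" "e > 0"
  obtains p :: "real poly" where
    "\<And>u. u \<ge> 0 \<Longrightarrow> of_bool (u \<le> a) - e * exp (- u) \<le> exp (- u) * poly p (exp (- u))"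
    "\<And>u. u \<ge> 0 \<Longrightarrow> exp (- u) * poly p (exp (- u)) \<le> of_bool (u \<le> b) + e * exp (- u)"
proof -
  \<comment> \<open>Bounding \<open>v\<close> below by \<open>exp (- b)\<close>, where the ramp has reached 0, keeps \<open>f\<close> continuous at \<open>v = 0\<close>.\<close>
  define m where "m v = max v (exp (- b))" for v
  define f where "f v = max 0 (min 1 ((b + ln (m v)) / (b - a))) / m v" for v
  have mpos: "m v > 0" for v by (simp add: m_def max_def not_le) (use exp_gt_zero[of "-b"] in linarith)
  have mcont: "continuous_on {0..1} m" unfolding m_def by (intro continuous_intros)
  have "continuous_on {0..1} f"
    unfolding f_def using assms mpos by (intro continuous_intros mcont) (auto simp: less_imp_neq[OF mpos, symmetric])
  then obtain g where g: "real_polynomial_function g" "\<And>v. v \<in> {0..1} \<Longrightarrow> \<bar>f v - g v\<bar> < e"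
    using Stone_Weierstrass_real_polynomial_function[of "{0..1}" f e] assms(3) by auto
  then obtain c n where c: "g = (\<lambda>v. \<Sum>i\<le>n. c i * v ^ i)"
    unfolding real_polynomial_function_iff_sum by blast
  define p where "p = (\<Sum>i\<le>n. monom (c i) i)"
  have p: "poly p v = g v" for v
    by (simp add: p_def c poly_sum poly_monom)
  have fu: "exp (- u) * f (exp (- u)) = max 0 (min 1 ((b - u) / (b - a)))" if "u \<ge> 0" for u
  proof (cases "u \<le> b")
    case True
    then have "m (exp (- u)) = exp (- u)" by (simp add: m_def)
    then show ?thesis by (simp add: f_def)
  next
    case False
    then have "m (exp (- u)) = exp (- b)" by (simp add: m_def)
    moreover have "(b - u) / (b - a) < 0" using False assms by (simp add: divide_neg_pos)
    ultimately show ?thesis by (simp add: f_def)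
  qed
  have close: "\<bar>exp (- u) * poly p (exp (- u)) - exp (- u) * f (exp (- u))\<bar> \<le> e * exp (- u)" if "u \<ge> 0" for u
  proof -
    have "\<bar>f (exp (- u)) - poly p (exp (- u))\<bar> \<le> e" using g(2)[of "exp (-u)"] that by (simp add: p)
    then have "exp (- u) * \<bar>poly p (exp (- u)) - f (exp (- u))\<bar> \<le> exp (- u) * e"
      by (intro mult_left_mono) auto
    then show ?thesis
      by (simp add: right_diff_distrib[symmetric] abs_mult mult.commute del: right_diff_distrib)
  qed
  show ?thesis
  proof (rule that[of p])
    fix u :: real assume u: "u \<ge> 0"
    have "of_bool (u \<le> a) \<le> max 0 (min 1 ((b - u) / (b - a)))"
      using assms by (auto simp: field_simps)
    then show "of_bool (u \<le> a) - e * exp (- u) \<le> exp (- u) * poly p (exp (- u))"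
      using close[OF u] fu[OF u] by linarith
    have "max 0 (min 1 ((b - u) / (b - a))) \<le> of_bool (u \<le> b)"
      using assms by (auto simp: field_simps)
    then show "exp (- u) * poly p (exp (- u)) \<le> of_bool (u \<le> b) + e * exp (- u)"
      using close[OF u] fu[OF u] by linarith
  qed
qed

text \<open>
  The value of \<open>\<integral> u\<^bsup>\<rho>-1\<^esup> e\<^bsup>-u\<^esup> p(e\<^bsup>-u\<^esup>) du\<close> over the half-line, divided by \<open>\<Gamma> \<rho>\<close> (for \<open>\<rho> > 0\<close>), computed
  monomial by monomial.
\<close>

definition laplace_moment :: "real \<Rightarrow> real poly \<Rightarrow> real" where
  "laplace_moment \<rho> p = (\<Sum>k\<le>degree p. coeff p k * real (k + 1) powr - \<rho>)"

lemma laplace_moment_has_integral: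
  assumes "\<rho> > 0"
  shows "((\<lambda>u. u powr (\<rho> - 1) * (exp (- u) * poly p (exp (- u)))) has_integral
           Gamma \<rho> * laplace_moment \<rho> p) {0<..}"
proof -
  have "((\<lambda>u. \<Sum>k\<le>degree p. coeff p k * (u powr (\<rho> - 1) * exp (- (real (k + 1) * u)))) has_integral
           (\<Sum>k\<le>degree p. coeff p k * (Gamma \<rho> * real (k + 1) powr - \<rho>))) {0<..}"
    using assms by (intro has_integral_sum has_integral_mult_right has_integral_powr_exp) auto
  moreover have "(\<Sum>k\<le>degree p. coeff p k * (u powr (\<rho> - 1) * exp (- (real (k + 1) * u))))
     = u powr (\<rho> - 1) * (exp (- u) * poly p (exp (- u)))" for u
    by (simp add: poly_altdef sum_distrib_left exp_of_nat_mult[symmetric] algebra_simps mult_exp_exp)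
  ultimately show ?thesis
    by (simp add: laplace_moment_def sum_distrib_left mult_ac)
qed

text \<open>
  A monomial in \<open>exp (- s n)\<close> only replaces \<open>s\<close> by a multiple of \<open>s\<close> in the Abel sum, so the hypothesis
  extends from the constant polynomial to all polynomials by linearity.
\<close>

lemma poly_laplace_tendsto:
  fixes a :: "nat \<Rightarrow> real"
  assumes sm: "\<And>s. s > 0 \<Longrightarrow> summable (\<lambda>n. a n * exp (- s * real n))"
    and lim: "((\<lambda>s. s powr \<rho> * (\<Sum>n. a n * exp (- s * real n))) \<longlongrightarrow> C) (at_right 0)"
  shows "\<And>s. s > 0 \<Longrightarrow> summable (\<lambda>n. a n * (exp (- s * real n) * poly p (exp (- s * real n))))"
    and "((\<lambda>s. s powr \<rho> * (\<Sum>n. a n * (exp (- s * real n) * poly p (exp (- s * real n)))))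
            \<longlongrightarrow> C * laplace_moment \<rho> p) (at_right 0)"
proof -
  define A where "A s = (\<Sum>n. a n * exp (- s * real n))" for s
  have eq: "a n * (exp (- s * real n) * poly p (exp (- s * real n)))
     = (\<Sum>k\<le>degree p. coeff p k * (a n * exp (- (real (k + 1) * s) * real n)))" for n s
  proof -
    have "exp (- (real (k + 1) * s) * real n) = exp (- s * real n) * exp (- s * real n) ^ k" for k
      using exp_of_nat_mult[of "k + 1" "- s * real n"] by (simp add: mult.assoc)
    then show ?thesis
      by (simp only: poly_altdef sum_distrib_left) (intro sum.cong refl, simp add: mult_ac)
  qed
  have sums: "(\<lambda>n. a n * (exp (- s * real n) * poly p (exp (- s * real n)))) sums
      (\<Sum>k\<le>degree p. coeff p k * A (real (k + 1) * s))" if "s > 0" for s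
    unfolding eq A_def using that
    by (intro sums_sum sums_mult summable_sums sm) auto
  then show "summable (\<lambda>n. a n * (exp (- s * real n) * poly p (exp (- s * real n))))" if "s > 0" for s
    using that by (auto simp: sums_iff)
  have "((\<lambda>s. \<Sum>k\<le>degree p. coeff p k * real (k + 1) powr - \<rho> * ((real (k + 1) * s) powr \<rho> * A (real (k + 1) * s)))
      \<longlongrightarrow> (\<Sum>k\<le>degree p. coeff p k * real (k + 1) powr - \<rho> * C)) (at_right 0)"
  proof (intro tendsto_sum tendsto_mult tendsto_const)
    fix k :: nat
    have "filterlim (\<lambda>s. real (k + 1) * s) (at_right 0) (at_right 0)"
      by real_asymp
    from filterlim_compose[OF lim[folded A_def] this]
    show "((\<lambda>s. (real (k + 1) * s) powr \<rho> * A (real (k + 1) * s)) \<longlongrightarrow> C) (at_right 0)" .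
  qed
  moreover have "(\<Sum>k\<le>degree p. coeff p k * real (k + 1) powr - \<rho> * C) = C * laplace_moment \<rho> p"
    by (simp add: laplace_moment_def sum_distrib_left mult_ac)
  moreover have "\<forall>\<^sub>F s in at_right 0. (\<Sum>k\<le>degree p. coeff p k * real (k + 1) powr - \<rho> * ((real (k + 1) * s) powr \<rho> * A (real (k + 1) * s)))
     = s powr \<rho> * (\<Sum>n. a n * (exp (- s * real n) * poly p (exp (- s * real n))))"
    using eventually_at_right_less[of 0]
  proof eventually_elim
    case (elim s)
    show ?case
      unfolding sums_unique[OF sums[OF elim], symmetric] sum_distrib_left
    proof (intro sum.cong refl)
      fix k
      have "(real (k + 1) * s) powr \<rho> = real (k + 1) powr \<rho> * s powr \<rho>"
        by (rule powr_mult)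
      moreover have "real (k + 1) powr - \<rho> * real (k + 1) powr \<rho> = 1"
        by (simp add: powr_minus)
      ultimately show "coeff p k * real (k + 1) powr - \<rho> * ((real (k + 1) * s) powr \<rho> * A (real (k + 1) * s))
          = s powr \<rho> * (coeff p k * A (real (k + 1) * s))"
        by (simp add: mult_ac)
    qed
  qed
  ultimately show "((\<lambda>s. s powr \<rho> * (\<Sum>n. a n * (exp (- s * real n) * poly p (exp (- s * real n)))))
            \<longlongrightarrow> C * laplace_moment \<rho> p) (at_right 0)"
    by (simp add: tendsto_cong)
qed

lemma has_integral_powr_cutoff:
  fixes \<rho> b :: real
  assumes "\<rho> > 0" "b > 0"
  shows "((\<lambda>u. u powr (\<rho> - 1) * of_bool (u \<le> b)) has_integral b powr \<rho> / \<rho>) {0<..}"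
proof -
  have "((\<lambda>u. u powr (\<rho> - 1)) has_integral b powr \<rho> / \<rho>) {0..b}"
    using has_integral_powr_from_0[of "\<rho> - 1" b] assms by simp
  then have "((\<lambda>u. u powr (\<rho> - 1)) has_integral b powr \<rho> / \<rho>) {0<..b}"
    by (rule iffD1[OF has_integral_spike_set_eq, rotated 2])
       (auto intro: negligible_subset[OF negligible_sing[of 0]])
  then have "((\<lambda>u. if u \<in> {0<..b} then u powr (\<rho> - 1) else 0) has_integral b powr \<rho> / \<rho>) {0<..}"
    by (subst has_integral_restrict) auto
  then show ?thesis
    by (rule has_integral_eq[rotated]) auto
qed

text \<open>
  The partial sum up to \<open>N\<close> is the Abel sum at \<open>s = 1 / N\<close> with \<open>exp (- u)\<close>, \<open>u = n / N\<close>, replaced by the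
  cutoff \<open>u \<le> 1\<close>.  Since \<open>a\<close> is nonnegative, polynomials above and below the cutoff give upper and
  lower bounds; their limits are known, and they differ from the value for the sharp cutoff by as
  little as desired.
\<close>

theorem karamata_tauberian:
  fixes a :: "nat \<Rightarrow> real"
  assumes a: "\<And>n. a n \<ge> 0" and \<rho>: "\<rho> > 0"
    and sm: "\<And>s. s > 0 \<Longrightarrow> summable (\<lambda>n. a n * exp (- s * real n))"
    and lim: "((\<lambda>s. s powr \<rho> * (\<Sum>n. a n * exp (- s * real n))) \<longlongrightarrow> C) (at_right 0)"
  shows "(\<lambda>N. (\<Sum>n\<le>N. a n) / real N powr \<rho>) \<longlonglongrightarrow> C / Gamma (\<rho> + 1)"
proof -
  have G: "Gamma \<rho> > 0" using \<rho> by simp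
  then have G0: "Gamma \<rho> \<noteq> 0" by linarith
  have G1: "Gamma (\<rho> + 1) = \<rho> * Gamma \<rho>" using \<rho> by (intro Gamma_plus1) auto
  have C: "C \<ge> 0"
  proof (rule tendsto_lowerbound[OF lim])
    show "\<forall>\<^sub>F s in at_right 0. s powr \<rho> * (\<Sum>n. a n * exp (- s * real n)) \<ge> 0"
      using eventually_at_right_less[of 0]
      by eventually_elim (intro mult_nonneg_nonneg suminf_nonneg sm, use a in auto)
  qed auto
  define T where "T p N = real N powr - \<rho> * (\<Sum>n. a n * (exp (- (real n / real N)) * poly p (exp (- (real n / real N)))))" for p N
  have Tlim: "T p \<longlonglongrightarrow> C * laplace_moment \<rho> p" for p
  proof -
    have "filterlim (\<lambda>N. 1 / real N) (at_right 0) sequentially" by real_asymp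
    from filterlim_compose[OF poly_laplace_tendsto(2)[OF sm lim, of p] this]
    have lim': "(\<lambda>N. (1 / real N) powr \<rho> * (\<Sum>n. a n * (exp (- (1 / real N) * real n) * poly p (exp (- (1 / real N) * real n)))))
        \<longlonglongrightarrow> C * laplace_moment \<rho> p" .
    have "eventually (\<lambda>N. (1 / real N) powr \<rho> * (\<Sum>n. a n * (exp (- (1 / real N) * real n) * poly p (exp (- (1 / real N) * real n)))) = T p N) sequentially"
      using eventually_gt_at_top[of 0]
      by eventually_elim (simp add: T_def inverse_powr powr_minus divide_inverse mult_ac)
    from Lim_transform_eventually[OF lim' this] show ?thesis .
  qed
  have Tsum: "summable (\<lambda>n. a n * (exp (- (real n / real N)) * poly p (exp (- (real n / real N)))))" if "N > 0" for p N
    using poly_laplace_tendsto(1)[OF sm lim, of "1 / real N" p] that by simp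
  have Ssum: "(\<lambda>n. a n * of_bool (real n / real N \<le> 1)) sums (\<Sum>n\<le>N. a n)" if "N > 0" for N
  proof -
    have "(\<lambda>n. if n \<in> {..N} then a n else 0) sums (\<Sum>n\<le>N. a n)" by (rule sums_If_finite_set) auto
    moreover have "(if n \<in> {..N} then a n else 0) = a n * of_bool (real n / real N \<le> 1)" for n
      using that by (auto simp: field_simps)
    ultimately show ?thesis by simp
  qed
  show ?thesis
  proof (rule order_tendstoI)
    fix y assume y: "C / Gamma (\<rho> + 1) < y"
    have "((\<lambda>h. C * ((1 + h) powr \<rho> / \<rho> + 2 * h * Gamma \<rho>) / Gamma \<rho>) \<longlongrightarrow>
        C * ((1 + 0) powr \<rho> / \<rho> + 2 * 0 * Gamma \<rho>) / Gamma \<rho>) (at_right 0)"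
      using \<rho> by (intro tendsto_intros) (auto simp: G0)
    then have "eventually (\<lambda>h. C * ((1 + h) powr \<rho> / \<rho> + 2 * h * Gamma \<rho>) / Gamma \<rho> < y) (at_right 0)"
      by (rule order_tendstoD) (use y G1 in auto)
    then have "eventually (\<lambda>h. C * ((1 + h) powr \<rho> / \<rho> + 2 * h * Gamma \<rho>) / Gamma \<rho> < y \<and> h > 0) (at_right 0)"
      using eventually_at_right_less[of 0] by eventually_elim auto
    then obtain h where h: "C * ((1 + h) powr \<rho> / \<rho> + 2 * h * Gamma \<rho>) / Gamma \<rho> < y" "h > 0"
      using eventually_happens'[of "at_right (0::real)"] by (auto simp: trivial_limit_at_right_real)
    obtain p where p:
      "\<And>u. u \<ge> 0 \<Longrightarrow> of_bool (u \<le> 1) - h * exp (- u) \<le> exp (- u) * poly p (exp (- u))"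
      "\<And>u. u \<ge> 0 \<Longrightarrow> exp (- u) * poly p (exp (- u)) \<le> of_bool (u \<le> 1 + h) + h * exp (- u)"
      using exp_cutoff_approx[of 1 "1 + h" h] h(2) by auto
    \<comment> \<open>Shifting by \<open>h\<close> absorbs the uniform error and makes the bound one-sided.\<close>
    define q where "q = p + [:h:]"
    have q1: "of_bool (u \<le> 1) \<le> exp (- u) * poly q (exp (- u))" if "u \<ge> 0" for u
      using p(1)[OF that] by (simp add: q_def algebra_simps)
    have q2: "exp (- u) * poly q (exp (- u)) \<le> of_bool (u \<le> 1 + h) + 2 * h * exp (- u)" if "u \<ge> 0" for u
      using p(2)[OF that] by (simp add: q_def algebra_simps)
    have "((\<lambda>u. u powr (\<rho> - 1) * of_bool (u \<le> 1 + h) + 2 * h * (u powr (\<rho> - 1) * exp (- (1 * u)))) has_integral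
       (1 + h) powr \<rho> / \<rho> + 2 * h * (Gamma \<rho> * 1 powr - \<rho>)) {0<..}"
      using \<rho> h(2) by (intro has_integral_add has_integral_mult_right has_integral_powr_exp has_integral_powr_cutoff) auto
    moreover have "u powr (\<rho> - 1) * (exp (- u) * poly q (exp (- u)))
        \<le> u powr (\<rho> - 1) * of_bool (u \<le> 1 + h) + 2 * h * (u powr (\<rho> - 1) * exp (- (1 * u)))" if "u \<in> {0<..}" for u
      using mult_left_mono[OF q2[of u] powr_ge_zero[of u "\<rho> - 1"]] that by (simp add: algebra_simps)
    ultimately have "Gamma \<rho> * laplace_moment \<rho> q \<le> (1 + h) powr \<rho> / \<rho> + 2 * h * (Gamma \<rho> * 1 powr - \<rho>)"
      by (rule has_integral_le[OF laplace_moment_has_integral[OF \<rho>, of q]])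
    then have "Gamma \<rho> * laplace_moment \<rho> q \<le> (1 + h) powr \<rho> / \<rho> + 2 * h * Gamma \<rho>"
      by simp
    then have "laplace_moment \<rho> q \<le> ((1 + h) powr \<rho> / \<rho> + 2 * h * Gamma \<rho>) / Gamma \<rho>"
      using G by (simp add: field_simps)
    from mult_left_mono[OF this C] h(1) have "C * laplace_moment \<rho> q < y" by simp
    from order_tendstoD(2)[OF Tlim this] have "eventually (\<lambda>N. T q N < y) sequentially" .
    then show "eventually (\<lambda>N. (\<Sum>n\<le>N. a n) / real N powr \<rho> < y) sequentially"
      using eventually_gt_at_top[of 0]
    proof eventually_elim
      case (elim N)
      have "(\<Sum>n\<le>N. a n) \<le> (\<Sum>n. a n * (exp (- (real n / real N)) * poly q (exp (- (real n / real N)))))"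
        unfolding sums_unique[OF Ssum[OF elim(2)]]
        using Ssum[OF elim(2)] Tsum[OF elim(2), of q] 
        by (intro suminf_le mult_left_mono q1 a) (auto simp: sums_iff)
      then have "real N powr - \<rho> * (\<Sum>n\<le>N. a n) \<le> T q N"
        unfolding T_def by (intro mult_left_mono) auto
      with elim(1) have "real N powr - \<rho> * (\<Sum>n\<le>N. a n) < y" by linarith
      then show ?case by (simp add: powr_minus divide_inverse mult.commute)
    qed
  next
    fix y assume y: "y < C / Gamma (\<rho> + 1)"
    have "((\<lambda>h. C * ((1 - h) powr \<rho> / \<rho> - 2 * h * Gamma \<rho>) / Gamma \<rho>) \<longlongrightarrow>
        C * ((1 - 0) powr \<rho> / \<rho> - 2 * 0 * Gamma \<rho>) / Gamma \<rho>) (at_right 0)"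
      using \<rho> by (intro tendsto_intros) (auto simp: G0)
    then have "eventually (\<lambda>h. C * ((1 - h) powr \<rho> / \<rho> - 2 * h * Gamma \<rho>) / Gamma \<rho> > y) (at_right 0)"
      by (rule order_tendstoD) (use y G1 in auto)
    moreover have "eventually (\<lambda>h::real. h < 1) (at_right 0)" by real_asymp
    ultimately have "eventually (\<lambda>h. C * ((1 - h) powr \<rho> / \<rho> - 2 * h * Gamma \<rho>) / Gamma \<rho> > y \<and> h > 0 \<and> h < 1) (at_right 0)"
      using eventually_at_right_less[of 0] by eventually_elim auto
    then obtain h where h: "C * ((1 - h) powr \<rho> / \<rho> - 2 * h * Gamma \<rho>) / Gamma \<rho> > y" "h > 0" "h < 1"
      using eventually_happens'[of "at_right (0::real)"] by (auto simp: trivial_limit_at_right_real)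
    obtain p where p:
      "\<And>u. u \<ge> 0 \<Longrightarrow> of_bool (u \<le> 1 - h) - h * exp (- u) \<le> exp (- u) * poly p (exp (- u))"
      "\<And>u. u \<ge> 0 \<Longrightarrow> exp (- u) * poly p (exp (- u)) \<le> of_bool (u \<le> 1) + h * exp (- u)"
      using exp_cutoff_approx[of "1 - h" 1 h] h(2,3) by auto
    define q where "q = p - [:h:]"
    have q1: "exp (- u) * poly q (exp (- u)) \<le> of_bool (u \<le> 1)" if "u \<ge> 0" for u
      using p(2)[OF that] by (simp add: q_def algebra_simps)
    have q2: "of_bool (u \<le> 1 - h) - 2 * h * exp (- u) \<le> exp (- u) * poly q (exp (- u))" if "u \<ge> 0" for u
      using p(1)[OF that] by (simp add: q_def algebra_simps)
    have "((\<lambda>u. u powr (\<rho> - 1) * of_bool (u \<le> 1 - h) - 2 * h * (u powr (\<rho> - 1) * exp (- (1 * u)))) has_integral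
       (1 - h) powr \<rho> / \<rho> - 2 * h * (Gamma \<rho> * 1 powr - \<rho>)) {0<..}"
      using \<rho> h(2,3) by (intro has_integral_diff has_integral_mult_right has_integral_powr_exp has_integral_powr_cutoff) auto
    moreover have "u powr (\<rho> - 1) * of_bool (u \<le> 1 - h) - 2 * h * (u powr (\<rho> - 1) * exp (- (1 * u)))
        \<le> u powr (\<rho> - 1) * (exp (- u) * poly q (exp (- u)))" if "u \<in> {0<..}" for u
      using mult_left_mono[OF q2[of u] powr_ge_zero[of u "\<rho> - 1"]] that by (simp add: algebra_simps)
    ultimately have "(1 - h) powr \<rho> / \<rho> - 2 * h * (Gamma \<rho> * 1 powr - \<rho>) \<le> Gamma \<rho> * laplace_moment \<rho> q"
      by (rule has_integral_le[OF _ laplace_moment_has_integral[OF \<rho>, of q]])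
    then have "(1 - h) powr \<rho> / \<rho> - 2 * h * Gamma \<rho> \<le> Gamma \<rho> * laplace_moment \<rho> q"
      by simp
    then have "((1 - h) powr \<rho> / \<rho> - 2 * h * Gamma \<rho>) / Gamma \<rho> \<le> laplace_moment \<rho> q"
      using G by (simp add: field_simps)
    from mult_left_mono[OF this C] h(1) have "C * laplace_moment \<rho> q > y" by simp
    from order_tendstoD(1)[OF Tlim this] have "eventually (\<lambda>N. T q N > y) sequentially" .
    then show "eventually (\<lambda>N. (\<Sum>n\<le>N. a n) / real N powr \<rho> > y) sequentially"
      using eventually_gt_at_top[of 0]
    proof eventually_elim
      case (elim N)
      have "(\<Sum>n\<le>N. a n) \<ge> (\<Sum>n. a n * (exp (- (real n / real N)) * poly q (exp (- (real n / real N)))))"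
        unfolding sums_unique[OF Ssum[OF elim(2)]]
        using Ssum[OF elim(2)] Tsum[OF elim(2), of q] 
        by (intro suminf_le mult_left_mono q1 a) (auto simp: sums_iff)
      then have "T q N \<le> real N powr - \<rho> * (\<Sum>n\<le>N. a n)"
        unfolding T_def by (intro mult_left_mono) auto
      with elim(1) have "real N powr - \<rho> * (\<Sum>n\<le>N. a n) > y" by linarith
      then show ?case by (simp add: powr_minus divide_inverse mult.commute)
    qed
  qed
qed

section \<open>Parseval's identity on a circle\<close>

lemma has_integral_cis_period:
  fixes k :: int
  shows "((\<lambda>\<theta>. cis (of_int k * \<theta>)) has_integral (if k = 0 then of_real (2 * pi) else 0)) {-pi..pi}"
proof (cases "k = 0")
  case True
  then show ?thesis
    using has_integral_const_real[of "1::complex" "-pi" pi] by (simp add: scaleR_conv_of_real)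
next
  case False
  define g where "g \<theta> = cis (of_int k * \<theta>) / (\<i> * of_int k)" for \<theta> :: real
  have "((\<lambda>\<theta>. cis (of_int k * \<theta>)) has_integral (g pi - g (-pi))) {-pi..pi}"
  proof (rule fundamental_theorem_of_calculus)
    fix \<theta> :: real
    have "((\<lambda>z. exp (\<i> * of_int k * z) / (\<i> * of_int k)) has_field_derivative exp (\<i> * of_int k * of_real \<theta>)) (at (of_real \<theta>))"
      using False by (auto intro!: derivative_eq_intros)
    from has_vector_derivative_real_field[OF this]
    show "(g has_vector_derivative cis (of_int k * \<theta>)) (at \<theta> within {-pi..pi})"
      by (auto simp: g_def[abs_def] cis_conv_exp mult_ac intro: has_vector_derivative_at_within)
  qed auto
  moreover have "g pi = g (-pi)"
  proof -
    have "cis (of_int k * pi) = cis (of_int k * (-pi) + 2 * pi * of_int k)" by (simp add: mult.commute)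
    also have "\<dots> = cis (of_int k * (-pi)) * cis (2 * pi * of_int k)" by (simp only: cis_mult)
    also have "cis (2 * pi * of_int k) = 1" by (rule cis_multiple_2pi) auto
    finally show ?thesis by (simp add: g_def)
  qed
  ultimately show ?thesis using False by simp
qed

lemma parseval_polynomial:
  fixes c :: "nat \<Rightarrow> complex" and r :: real
  shows "((\<lambda>\<theta>. (norm (\<Sum>n<M. c n * (of_real r * cis \<theta>) ^ n))\<^sup>2) has_integral
           2 * pi * (\<Sum>n<M. (norm (c n))\<^sup>2 * r ^ (2 * n))) {-pi..pi}"
proof -
  define w where "w n m = c n * cnj (c m) * of_real (r ^ n * r ^ m)" for n m
  have "((\<lambda>\<theta>. \<Sum>n<M. \<Sum>m<M. w n m * cis (of_int (int n - int m) * \<theta>)) has_integral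
      (\<Sum>n<M. \<Sum>m<M. w n m * (if int n - int m = 0 then of_real (2 * pi) else 0))) {-pi..pi}"
    by (intro has_integral_sum has_integral_mult_right has_integral_cis_period) auto
  moreover have "(\<Sum>n<M. \<Sum>m<M. w n m * cis (of_int (int n - int m) * \<theta>))
      = of_real ((norm (\<Sum>n<M. c n * (of_real r * cis \<theta>) ^ n))\<^sup>2)" for \<theta>
  proof -
    have "w n m * cis (of_int (int n - int m) * \<theta>)
        = (c n * (of_real r * cis \<theta>) ^ n) * cnj (c m * (of_real r * cis \<theta>) ^ m)" for n m
      by (simp add: w_def power_mult_distrib Complex.DeMoivre cis_cnj cis_mult algebra_simps
               del: cis_mult) (simp add: cis_mult algebra_simps)
    then show ?thesis
      unfolding complex_norm_square cnj_sum sum_product by simp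
  qed
  moreover have "(\<Sum>n<M. \<Sum>m<M. w n m * (if int n - int m = 0 then of_real (2 * pi) else 0))
      = of_real (2 * pi * (\<Sum>n<M. (norm (c n))\<^sup>2 * r ^ (2 * n)))"
  proof -
    have "(\<Sum>m<M. w n m * (if int n - int m = 0 then of_real (2 * pi) else 0)) = w n n * of_real (2 * pi)"
      if "n < M" for n
    proof -
      have "(\<Sum>m<M. w n m * (if int n - int m = 0 then of_real (2 * pi) else 0))
          = (\<Sum>m<M. if n = m then w n m * of_real (2 * pi) else 0)"
        by (intro sum.cong) auto
      then show ?thesis using that by simp
    qed
    moreover have "w n n = of_real ((norm (c n))\<^sup>2 * r ^ (2 * n))" for n
      unfolding w_def of_real_mult complex_norm_square by (simp add: power_add[symmetric] mult_2)
    ultimately show ?thesis by (simp add: sum_distrib_left sum_distrib_right mult_ac)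
  qed
  ultimately have "((\<lambda>\<theta>. complex_of_real ((norm (\<Sum>n<M. c n * (of_real r * cis \<theta>) ^ n))\<^sup>2)) has_integral
      of_real (2 * pi * (\<Sum>n<M. (norm (c n))\<^sup>2 * r ^ (2 * n)))) {-pi..pi}" by simp
  from has_integral_linear[OF this bounded_linear_Re] show ?thesis by (simp add: o_def)
qed

text \<open>
  Holds exactly for the Taylor polynomials by orthogonality of the characters; absolute convergence
  on the circle bounds these uniformly, so dominated convergence passes to the limit.
\<close>

theorem parseval_circle:
  fixes c :: "nat \<Rightarrow> complex" and r :: real and F :: "real \<Rightarrow> complex"
  assumes r: "r \<ge> 0" and sm: "summable (\<lambda>n. norm (c n) * r ^ n)"
    and F: "\<And>\<theta>. (\<lambda>n. c n * (of_real r * cis \<theta>) ^ n) sums F \<theta>"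
  shows "(\<lambda>n. (norm (c n))\<^sup>2 * r ^ (2 * n)) sums
           ((\<integral>\<theta>. indicator {-pi..pi} \<theta> * (norm (F \<theta>))\<^sup>2 \<partial>lborel) / (2 * pi))"
proof -
  define P where "P M \<theta> = (\<Sum>n<M. c n * (of_real r * cis \<theta>) ^ n)" for M \<theta>
  define K where "K = (\<Sum>n. norm (c n) * r ^ n)"
  have K: "norm (P M \<theta>) \<le> K" for M \<theta>
  proof -
    have "norm (P M \<theta>) \<le> (\<Sum>n<M. norm (c n) * r ^ n)"
      unfolding P_def using r by (intro sum_norm_le) (simp add: norm_mult norm_power)
    also have "\<dots> \<le> K"
      unfolding K_def using sm r by (intro sum_le_suminf) auto
    finally show ?thesis .
  qed
  have Pcont: "continuous_on A (P M)" for A M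
    unfolding P_def by (intro continuous_intros)
  have Plim: "(\<lambda>M. P M \<theta>) \<longlonglongrightarrow> F \<theta>" for \<theta>
    using F[of \<theta>] by (simp add: sums_def P_def)
  have Pm[measurable]: "P M \<in> borel_measurable borel" for M
    by (intro borel_measurable_continuous_onI Pcont)
  have Fm[measurable]: "F \<in> borel_measurable borel"
    by (rule borel_measurable_LIMSEQ_metric[OF Pm Plim])
  have "(\<lambda>M. \<integral>\<theta>. indicator {-pi..pi} \<theta> * (norm (P M \<theta>))\<^sup>2 \<partial>lborel) \<longlonglongrightarrow>
        (\<integral>\<theta>. indicator {-pi..pi} \<theta> * (norm (F \<theta>))\<^sup>2 \<partial>lborel)"
  proof (rule integral_dominated_convergence[where w = "\<lambda>\<theta>. indicator {-pi..pi} \<theta> * K\<^sup>2"])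
    show "AE \<theta> in lborel. (\<lambda>M. indicator {-pi..pi} \<theta> * (norm (P M \<theta>))\<^sup>2) \<longlonglongrightarrow>
        indicator {-pi..pi} \<theta> * (norm (F \<theta>))\<^sup>2"
      by (intro AE_I2 tendsto_intros Plim)
    show "AE \<theta> in lborel. norm (indicator {-pi..pi} \<theta> * (norm (P M \<theta>))\<^sup>2) \<le> indicator {-pi..pi} \<theta> * K\<^sup>2" for M
      using K by (intro AE_I2) (auto simp: indicator_def power_mono)
    show "integrable lborel (\<lambda>\<theta>. indicator {-pi..pi} \<theta> * K\<^sup>2)" by simp
  qed measurable
  moreover have "(\<integral>\<theta>. indicator {-pi..pi} \<theta> * (norm (P M \<theta>))\<^sup>2 \<partial>lborel) = 2 * pi * (\<Sum>n<M. (norm (c n))\<^sup>2 * r ^ (2 * n))" for M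
  proof -
    have "set_integrable lborel {-pi..pi} (\<lambda>\<theta>. (norm (P M \<theta>))\<^sup>2)"
      by (intro borel_integrable_atLeastAtMost' continuous_intros Pcont)
    from set_borel_integral_eq_integral(2)[OF this]
    have "(\<integral>\<theta>. indicator {-pi..pi} \<theta> * (norm (P M \<theta>))\<^sup>2 \<partial>lborel) = integral {-pi..pi} (\<lambda>\<theta>. (norm (P M \<theta>))\<^sup>2)"
      by (simp add: set_lebesgue_integral_def)
    also have "\<dots> = 2 * pi * (\<Sum>n<M. (norm (c n))\<^sup>2 * r ^ (2 * n))"
      unfolding P_def by (intro integral_unique parseval_polynomial)
    finally show ?thesis .
  qed
  ultimately have "(\<lambda>M. 2 * pi * (\<Sum>n<M. (norm (c n))\<^sup>2 * r ^ (2 * n)) / (2 * pi)) \<longlonglongrightarrow>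
      (\<integral>\<theta>. indicator {-pi..pi} \<theta> * (norm (F \<theta>))\<^sup>2 \<partial>lborel) / (2 * pi)"
    by (intro tendsto_divide tendsto_const) auto
  then show ?thesis by (simp add: sums_def)
qed

section \<open>Laguerre polynomials by recurrence, and their generating function\<close>

text \<open>
  Defining the polynomials by their three-term recurrence makes both facts needed about them
  short inductions: their orthogonality, and their agreement with the Taylor coefficients of the
  generating function.
\<close>

fun laguerre :: "real \<Rightarrow> nat \<Rightarrow> real poly" where
  "laguerre \<alpha> 0 = 1"
| "laguerre \<alpha> (Suc 0) = [:\<alpha> + 1, - 1:]"
| "laguerre \<alpha> (Suc (Suc n)) = smult (1 / real (n + 2))
     ([:2 * real n + 3 + \<alpha>, - 1:] * laguerre \<alpha> (Suc n) - smult (real n + 1 + \<alpha>) (laguerre \<alpha> n))"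

lemma laguerre_degree_lead:
  "(\<forall>i>n. coeff (laguerre \<alpha> n) i = 0) \<and> coeff (laguerre \<alpha> n) n = (- 1) ^ n / fact n"
proof (induction \<alpha> n rule: laguerre.induct)
  case (3 \<alpha> n)
  then show ?case
    by (auto simp: mult_pCons_left coeff_pCons field_simps split: nat.splits)
qed (auto simp: coeff_pCons split: nat.splits)

text \<open>
  Orthogonality is linear algebra over this functional; analysis is needed only for its values on
  monomials.
\<close>

definition laguerre_functional :: "real \<Rightarrow> real poly \<Rightarrow> real" where
  "laguerre_functional \<alpha> p = (LBINT x:{0..}. x powr \<alpha> * exp (- x) * poly p x)"

lemma set_integrable_laguerre_monom:
  assumes "\<alpha> > - 1"
  shows "set_integrable lborel {0..} (\<lambda>x. x powr \<alpha> * exp (- x) * x ^ k)"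
    and "(LBINT x:{0..}. x powr \<alpha> * exp (- x) * x ^ k) = Gamma (\<alpha> + 1 + real k)"
proof -
  let ?f = "\<lambda>x::real. x powr \<alpha> * exp (- x) * x ^ k"
  have "((\<lambda>x. x powr ((\<alpha> + 1 + real k) - 1) / exp x) has_integral Gamma (\<alpha> + 1 + real k)) {0..}"
    by (rule Gamma_integral_real) (use assms in linarith)
  then have "((\<lambda>x. if x \<in> {0..} then x powr (\<alpha> + real k) / exp x else 0) has_integral Gamma (\<alpha> + 1 + real k)) UNIV"
    by (subst has_integral_restrict_UNIV) simp
  then have I: "((\<lambda>x. indicator {0..} x *\<^sub>R ?f x) has_integral Gamma (\<alpha> + 1 + real k)) UNIV"
  proof (rule has_integral_spike[of "{0}", rotated 2])
    show "indicator {0..} x *\<^sub>R ?f x = (if x \<in> {0..} then x powr (\<alpha> + real k) / exp x else 0)"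
      if "x \<in> UNIV - {0}" for x
      using that by (auto simp: powr_add powr_realpow exp_minus divide_inverse indicator_def)
  qed auto
  have m: "(\<lambda>x. indicator {0..} x *\<^sub>R ?f x) \<in> borel_measurable borel" by measurable
  have nn: "indicator {0..} x *\<^sub>R ?f x \<ge> 0" for x :: real by (auto simp: indicator_def)
  have "(\<integral>\<^sup>+ x. ennreal (indicator {0..} x *\<^sub>R ?f x) \<partial>lborel) = ennreal (Gamma (\<alpha> + 1 + real k))"
    by (rule nn_integral_has_integral_lborel[OF m nn I])
  from nn_integral_eq_integrable[THEN iffD1, OF _ _ _ this] m nn assms
  show "set_integrable lborel {0..} ?f"
    and "(LBINT x:{0..}. ?f x) = Gamma (\<alpha> + 1 + real k)"
    unfolding set_integrable_def set_lebesgue_integral_def by (auto intro!: less_imp_le Gamma_real_pos)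
qed

context
  fixes \<alpha> :: real
  assumes \<alpha>: "\<alpha> > - 1"
begin

lemma set_integrable_laguerre: "set_integrable lborel {0..} (\<lambda>x. x powr \<alpha> * exp (- x) * poly p x)"
proof -
  have "integrable lborel (\<lambda>x. \<Sum>i\<le>degree p.
      coeff p i * (indicator {0..} x *\<^sub>R (x powr \<alpha> * exp (- x) * x ^ i)))"
    using set_integrable_laguerre_monom(1)[OF \<alpha>] unfolding set_integrable_def
    by (intro Bochner_Integration.integrable_sum integrable_mult_right) auto
  then show ?thesis
    by (simp add: set_integrable_def poly_altdef sum_distrib_left mult_ac)
qed

lemma laguerre_functional_add:
  "laguerre_functional \<alpha> (p + q) = laguerre_functional \<alpha> p + laguerre_functional \<alpha> q"
  unfolding laguerre_functional_def
  using set_integral_add(2)[OF set_integrable_laguerre[of p] set_integrable_laguerre[of q]]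
  by (simp add: algebra_simps)

lemma laguerre_functional_smult: "laguerre_functional \<alpha> (smult c p) = c * laguerre_functional \<alpha> p"
  unfolding laguerre_functional_def by (simp add: mult.left_commute flip: set_integral_mult_right)

lemma laguerre_functional_diff:
  "laguerre_functional \<alpha> (p - q) = laguerre_functional \<alpha> p - laguerre_functional \<alpha> q"
  using laguerre_functional_add[of p "- q"] laguerre_functional_smult[of "- 1" q] by simp

lemma laguerre_functional_0: "laguerre_functional \<alpha> 0 = 0"
  by (simp add: laguerre_functional_def)

lemma laguerre_functional_sum: "laguerre_functional \<alpha> (\<Sum>i\<in>A. f i) = (\<Sum>i\<in>A. laguerre_functional \<alpha> (f i))"
  by (induction A rule: infinite_finite_induct) (auto simp: laguerre_functional_add laguerre_functional_0)

lemma laguerre_functional_monom: "laguerre_functional \<alpha> (monom 1 k) = Gamma (\<alpha> + 1 + real k)"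
  using set_integrable_laguerre_monom(2)[OF \<alpha>] by (simp add: laguerre_functional_def poly_monom)

text \<open>
  The full table of moments, not just the vanishing ones, is what the recurrence propagates: it expresses
  the moment \<open>m\<close> for one degree by the moments \<open>m\<close> and \<open>m + 1\<close> for the two preceding degrees.
  Orthogonality is the case \<open>m < n\<close>, where the binomial coefficient is 0.
\<close>

lemma laguerre_functional_laguerre_monom:
  "laguerre_functional \<alpha> (laguerre \<alpha> n * monom 1 m) = (- 1) ^ n * real (m choose n) * Gamma (\<alpha> + 1 + real m)"
proof (induction n arbitrary: m rule: induct_nat_012)
  case 0
  then show ?case by (simp add: laguerre_functional_monom)
next
  have G: "Gamma (\<alpha> + 1 + real (Suc m)) = (\<alpha> + 1 + real m) * Gamma (\<alpha> + 1 + real m)" for m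
  proof -
    have "\<alpha> + 1 + real m \<notin> \<int>\<^sub>\<le>\<^sub>0"
      using \<alpha> nonpos_Ints_nonpos[of "\<alpha> + 1 + real m"] by linarith
    from Gamma_plus1[OF this] show ?thesis by (simp add: add_ac)
  qed
  have step: "smult c ([:a, - 1:] * p - smult b q) * monom 1 m
      = smult c (smult a (p * monom 1 m) - p * monom 1 (Suc m) - smult b (q * monom 1 m))"
    for a b c :: real and p q and m
    by (simp add: poly_eq_poly_eq_iff[symmetric] fun_eq_iff poly_monom algebra_simps)
  have B: "(real m - real k) * real (m choose k) = real (Suc k) * real (m choose Suc k)" for m k
    using gbinomial_mult_1[of "real m" k] by (simp add: binomial_gbinomial algebra_simps)
  {
    case 1
    have "laguerre \<alpha> (Suc 0) * monom 1 m = smult (\<alpha> + 1) (monom 1 m) - monom 1 (Suc m)"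
      by (simp add: mult_pCons_left monom_Suc)
    then have "laguerre_functional \<alpha> (laguerre \<alpha> (Suc 0) * monom 1 m)
        = (\<alpha> + 1) * Gamma (\<alpha> + 1 + real m) - Gamma (\<alpha> + 1 + real (Suc m))"
      by (simp only: laguerre_functional_diff laguerre_functional_smult laguerre_functional_monom)
    then show ?case unfolding G by (simp add: algebra_simps)
  next
    case (ge2 n)
    have "laguerre \<alpha> (Suc (Suc n)) * monom 1 m = smult (1 / real (n + 2))
       (smult (2 * real n + 3 + \<alpha>) (laguerre \<alpha> (Suc n) * monom 1 m) - laguerre \<alpha> (Suc n) * monom 1 (Suc m)
        - smult (real n + 1 + \<alpha>) (laguerre \<alpha> n * monom 1 m))"
      by (simp only: laguerre.simps(3) step)
    then have "real (n + 2) * laguerre_functional \<alpha> (laguerre \<alpha> (Suc (Suc n)) * monom 1 m) =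
       (2 * real n + 3 + \<alpha>) * ((- 1) ^ Suc n * real (m choose Suc n) * Gamma (\<alpha> + 1 + real m))
       - (- 1) ^ Suc n * real (Suc m choose Suc n) * Gamma (\<alpha> + 1 + real (Suc m))
       - (real n + 1 + \<alpha>) * ((- 1) ^ n * real (m choose n) * Gamma (\<alpha> + 1 + real m))"
      by (simp only: laguerre_functional_smult laguerre_functional_diff ge2) simp
    also have "\<dots> = (- 1) ^ n * Gamma (\<alpha> + 1 + real m) *
       ((real m - 2 * real n - 2) * real (m choose Suc n) + (real m - real n) * real (m choose n))"
      unfolding G by (simp add: algebra_simps)
    also have "(real m - 2 * real n - 2) * real (m choose Suc n) + (real m - real n) * real (m choose n)
        = (real m - real (Suc n)) * real (m choose Suc n)"
      unfolding B[of m n] by (simp add: algebra_simps)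
    also have "\<dots> = real (n + 2) * real (m choose Suc (Suc n))"
      unfolding B[of m "Suc n"] by simp
    finally show ?case by simp
  }
qed

lemma laguerre_functional_orthogonal_low:
  assumes "\<And>i. i \<ge> n \<Longrightarrow> coeff q i = 0"
  shows "laguerre_functional \<alpha> (laguerre \<alpha> n * q) = 0"
proof -
  have "laguerre \<alpha> n * q = (\<Sum>i\<le>degree q. smult (coeff q i) (laguerre \<alpha> n * monom 1 i))"
    by (subst poly_as_sum_of_monoms[of q, symmetric])
       (simp add: sum_distrib_left smult_monom flip: mult_smult_right)
  then have "laguerre_functional \<alpha> (laguerre \<alpha> n * q)
      = (\<Sum>i\<le>degree q. coeff q i * ((- 1) ^ n * real (i choose n) * Gamma (\<alpha> + 1 + real i)))"
    by (simp add: laguerre_functional_sum laguerre_functional_smult laguerre_functional_laguerre_monom)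
  also have "\<dots> = 0"
  proof (intro sum.neutral ballI)
    fix i
    show "coeff q i * ((- 1) ^ n * real (i choose n) * Gamma (\<alpha> + 1 + real i)) = 0"
      using assms[of i] by (cases "i \<ge> n") (auto simp: binomial_eq_0)
  qed
  finally show ?thesis .
qed

text \<open>
  The difference \<open>D\<close> of the two polynomials of degree \<open>n\<close> has degree less than \<open>n\<close>, as their leading
  coefficients agree, and both are orthogonal to \<open>L d\<close> for \<open>d = degree D\<close>.  Up to lower degree \<open>D\<close> is a
  nonzero multiple of \<open>L d\<close>, so \<open>L d\<close> would have square integral 0, against the normalisation.
\<close>

theorem assoc_laguerre_polys_unique:
  assumes L: "assoc_laguerre_polys \<alpha> L"
  shows "L n = laguerre \<alpha> n"
proof -
  have deg: "degree (L n) = n" for n using L by (auto simp: assoc_laguerre_polys_def)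
  have lc: "coeff (L n) n = (- 1) ^ n / fact n" for n
    using L deg[of n] by (auto simp: assoc_laguerre_polys_def)
  have orth: "laguerre_functional \<alpha> (L m * L n) = 0" if "m \<noteq> n" for m n
    using L that by (auto simp: assoc_laguerre_polys_def laguerre_functional_def)
  have sq: "laguerre_functional \<alpha> (L n * L n) \<noteq> 0" for n
  proof -
    have "laguerre_functional \<alpha> (L n * L n) = Gamma (real n + \<alpha> + 1) / fact n"
      using L by (auto simp: assoc_laguerre_polys_def laguerre_functional_def power2_eq_square)
    moreover have "Gamma (real n + \<alpha> + 1) > 0" using \<alpha> by (intro Gamma_real_pos) auto
    ultimately show ?thesis by auto
  qed
  have low: "laguerre_functional \<alpha> (L n * q) = 0" if "k \<le> n" "\<And>i. i \<ge> k \<Longrightarrow> coeff q i = 0" for n k q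
    using that
  proof (induction k arbitrary: q)
    case 0
    then have "q = 0" by (simp add: poly_eq_iff)
    then show ?case by (simp add: laguerre_functional_0)
  next
    case (Suc k)
    define c where "c = coeff q k / coeff (L k) k"
    have "coeff (q - smult c (L k)) i = 0" if "i \<ge> k" for i
      using that Suc.prems(2)[of i] lc[of k] deg[of k]
      by (cases "i = k") (auto simp: c_def coeff_eq_0)
    then have "laguerre_functional \<alpha> (L n * (q - smult c (L k))) = 0"
      using Suc by auto
    then show ?case
      using orth[of n k] Suc.prems(1)
      by (simp add: right_diff_distrib laguerre_functional_diff laguerre_functional_smult)
  qed
  define D where "D = L n - laguerre \<alpha> n"
  have D: "coeff D i = 0" if "i \<ge> n" for i
    using that deg[of n] lc[of n] laguerre_degree_lead[of n \<alpha>]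
    by (cases "i = n") (auto simp: D_def coeff_eq_0)
  have "D = 0"
  proof (rule ccontr)
    assume "D \<noteq> 0"
    define d where "d = degree D"
    have d: "coeff D d \<noteq> 0" using \<open>D \<noteq> 0\<close> by (simp add: d_def)
    with D have dn: "d < n" by (meson not_le)
    define c where "c = coeff D d / coeff (L d) d"
    have c: "c \<noteq> 0" using d lc[of d] by (simp add: c_def)
    have "laguerre_functional \<alpha> (laguerre \<alpha> n * L d) = 0"
      using dn deg[of d] by (intro laguerre_functional_orthogonal_low) (auto simp: coeff_eq_0)
    then have "laguerre_functional \<alpha> (L d * D) = 0"
      using orth[of n d] dn
      by (simp add: D_def right_diff_distrib laguerre_functional_diff mult.commute)
    moreover have "laguerre_functional \<alpha> (L d * (D - smult c (L d))) = 0"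
    proof (rule low[OF order_refl])
      fix i assume "i \<ge> d"
      then show "coeff (D - smult c (L d)) i = 0"
        using lc[of d] deg[of d] by (cases "i = d") (auto simp: c_def coeff_eq_0 d_def)
    qed
    ultimately have "c * laguerre_functional \<alpha> (L d * L d) = 0"
      by (simp add: right_diff_distrib laguerre_functional_diff laguerre_functional_smult)
    with c sq show False by simp
  qed
  then show ?thesis by (simp add: D_def)
qed

end

text \<open>
  This is \<open>(1 - t)\<^bsup>-\<alpha>-1\<^esup> exp (- x t / (1 - t))\<close> with the principal branch of the power, which
  is holomorphic on the unit disc because \<open>1 - t\<close> has positive real part there.
\<close>

definition laguerre_gf :: "real \<Rightarrow> real \<Rightarrow> complex \<Rightarrow> complex" where
  "laguerre_gf \<alpha> x t = exp (- (of_real (\<alpha> + 1) * Ln (1 - t)) - of_real x * t / (1 - t))"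

lemma one_minus_not_nonpos: "norm (t :: complex) < 1 \<Longrightarrow> 1 - t \<notin> \<real>\<^sub>\<le>\<^sub>0"
  using complex_Re_le_cmod[of t] by (auto simp: complex_nonpos_Reals_iff)

lemma laguerre_gf_has_derivative:
  assumes "norm t < 1"
  shows "(laguerre_gf \<alpha> x has_field_derivative
           ((of_real (\<alpha> + 1) * (1 - t) - of_real x) / (1 - t)\<^sup>2 * laguerre_gf \<alpha> x t)) (at t)"
proof -
  have t: "1 - t \<noteq> 0" using assms by auto
  have "((\<lambda>t. - (of_real (\<alpha> + 1) * Ln (1 - t)) - of_real x * t / (1 - t)) has_field_derivative
      (of_real (\<alpha> + 1) / (1 - t) - of_real x / (1 - t)\<^sup>2)) (at t)"
    using t one_minus_not_nonpos[OF assms]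
    by (auto intro!: derivative_eq_intros simp: field_simps power2_eq_square)
  from DERIV_chain2[OF DERIV_exp this]
  have "(laguerre_gf \<alpha> x has_field_derivative
      laguerre_gf \<alpha> x t * (of_real (\<alpha> + 1) / (1 - t) - of_real x / (1 - t)\<^sup>2)) (at t)"
    by (simp only: laguerre_gf_def[abs_def])
  moreover have "(of_real (\<alpha> + 1) * (1 - t) - of_real x) / (1 - t)\<^sup>2 =
      of_real (\<alpha> + 1) / (1 - t) - of_real x / (1 - t)\<^sup>2"
    using t by (simp add: diff_divide_distrib power2_eq_square)
  ultimately show ?thesis by (simp only: mult.commute)
qed

lemma laguerre_gf_holomorphic: "laguerre_gf \<alpha> x holomorphic_on ball 0 1"
proof (subst holomorphic_on_open[OF open_ball], intro ballI)
  fix t :: complex assume "t \<in> ball 0 1"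
  then have "norm t < 1" by simp
  from laguerre_gf_has_derivative[OF this]
  show "\<exists>f'. (laguerre_gf \<alpha> x has_field_derivative f') (at t)" by (rule exI)
qed

text \<open>
  The differential equation of the generating function becomes the three-term recurrence for its Taylor
  coefficients.
\<close>

lemma laguerre_gf_coeffs:
  fixes \<alpha> x :: real
  defines "H \<equiv> fps_expansion (laguerre_gf \<alpha> x) 0"
  shows "laguerre_gf \<alpha> x has_fps_expansion H"
    and "fps_nth H n = of_real (poly (laguerre \<alpha> n) x)"
proof -
  let ?h = "laguerre_gf \<alpha> x"
  show H: "?h has_fps_expansion H"
    unfolding H_def by (rule has_fps_expansion_fps_expansion[OF _ _ laguerre_gf_holomorphic]) auto
  have A: "(\<lambda>t. ((1 - t) * (1 - t)) * deriv ?h t) has_fps_expansion ((1 - fps_X) * (1 - fps_X)) * fps_deriv H"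
    by (intro fps_expansion_intros H)
  have B: "(\<lambda>t. (of_real (\<alpha> + 1) * (1 - t) - of_real x) * ?h t) has_fps_expansion
       (fps_const (of_real (\<alpha> + 1)) * (1 - fps_X) - fps_const (of_real x)) * H"
    by (intro fps_expansion_intros H)
  have ode: "eventually (\<lambda>t. ((1 - t) * (1 - t)) * deriv ?h t = (of_real (\<alpha> + 1) * (1 - t) - of_real x) * ?h t) (nhds 0)"
  proof -
    have "eventually (\<lambda>t::complex. t \<in> ball 0 1) (nhds 0)"
      by (rule eventually_nhds_in_open) auto
    then show ?thesis
    proof eventually_elim
      case (elim t)
      then have t: "norm t < 1" "1 - t \<noteq> 0" by auto
      show ?case
        unfolding DERIV_imp_deriv[OF laguerre_gf_has_derivative[OF t(1)]]
        using t(2) by (simp add: power2_eq_square)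
    qed
  qed
  have eq: "((1 - fps_X) * (1 - fps_X)) * fps_deriv H =
       (fps_const (of_real (\<alpha> + 1)) * (1 - fps_X) - fps_const (of_real x)) * H"
    by (rule fps_expansion_unique_complex[OF iffD1[OF has_fps_expansion_cong[OF ode refl] A] B])
  have ring: "D - X * D - X * D + X * (X * D) = (c - d) * H - c * (X * H)"
    if "((1 - X) * (1 - X)) * D = (c * (1 - X) - d) * H" for X D c d H :: "complex fps"
    using that by (simp add: algebra_simps)
  have "fps_deriv H - fps_X * fps_deriv H - fps_X * fps_deriv H + fps_X * (fps_X * fps_deriv H) =
       fps_const (of_real (\<alpha> + 1 - x)) * H - fps_const (of_real (\<alpha> + 1)) * (fps_X * H)"
    using ring[OF eq] by simp
  then have rec: "fps_nth (fps_deriv H - fps_X * fps_deriv H - fps_X * fps_deriv H + fps_X * (fps_X * fps_deriv H)) n =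
       fps_nth (fps_const (of_real (\<alpha> + 1 - x)) * H - fps_const (of_real (\<alpha> + 1)) * (fps_X * H)) n" for n
    by simp
  show "fps_nth H n = of_real (poly (laguerre \<alpha> n) x)"
  proof (induction n rule: induct_nat_012)
    case 0
    then show ?case by (simp add: H_def fps_expansion_def laguerre_gf_def)
  next
    case 1
    have "fps_nth H 1 = of_real (\<alpha> + 1 - x) * fps_nth H 0"
      using rec[of 0] by simp
    also have "fps_nth H 0 = 1" by (simp add: H_def fps_expansion_def laguerre_gf_def)
    finally show ?case by simp
  next
    case (ge2 n)
    have "of_nat (n + 2) * fps_nth H (Suc (Suc n)) =
        of_real (2 * real n + 3 + \<alpha> - x) * fps_nth H (Suc n) - of_real (real n + 1 + \<alpha>) * fps_nth H n"
    proof -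
      have "of_nat (n + 2) * fps_nth H (Suc (Suc n)) - of_nat (Suc n) * fps_nth H (Suc n)
          - of_nat (Suc n) * fps_nth H (Suc n) + of_nat n * fps_nth H n
        = of_real (\<alpha> + 1 - x) * fps_nth H (Suc n) - of_real (\<alpha> + 1) * fps_nth H n"
        using rec[of "Suc n"] by (cases n) (simp_all add: mult.commute)
      then show ?thesis by (simp add: algebra_simps)
    qed
    also have "\<dots> = of_real ((2 * real n + 3 + \<alpha> - x) * poly (laguerre \<alpha> (Suc n)) x
        - (real n + 1 + \<alpha>) * poly (laguerre \<alpha> n) x)"
      unfolding ge2 by simp
    also have "(2 * real n + 3 + \<alpha> - x) * poly (laguerre \<alpha> (Suc n)) x - (real n + 1 + \<alpha>) * poly (laguerre \<alpha> n) x
        = real (n + 2) * poly (laguerre \<alpha> (Suc (Suc n))) x"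
    proof -
      have "real (n + 2) * (1 / real (n + 2) * z) = z" for z by simp
      then show ?thesis
        unfolding laguerre.simps(3) poly_smult by (simp only:) (simp add: algebra_simps)
    qed
    finally have "of_nat (n + 2) * fps_nth H (Suc (Suc n))
        = of_nat (n + 2) * of_real (poly (laguerre \<alpha> (Suc (Suc n))) x)"
      by (simp del: laguerre.simps)
    moreover have "(of_nat (n + 2) :: complex) \<noteq> 0" by (simp only: of_nat_eq_0_iff)
    ultimately show ?case by (simp only: mult_cancel_left) simp
  qed
qed

text \<open>
  A function holomorphic on the unit disc is the sum of its Taylor series on all of the disc, so no bound
  on the growth of \<open>L\<^sub>n(x)\<close> in \<open>n\<close> is required for convergence.
\<close>

theorem laguerre_gf_deriv_sums:
  assumes t: "norm t < 1"
  shows "(\<lambda>n. of_real (real n * poly (laguerre \<alpha> n) x) * t ^ n) sums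
           (t * (of_real (\<alpha> + 1) * (1 - t) - of_real x) / (1 - t)\<^sup>2 * laguerre_gf \<alpha> x t)"
proof -
  let ?H = "fps_expansion (laguerre_gf \<alpha> x) 0"
  have 1: "(\<lambda>t. t * deriv (laguerre_gf \<alpha> x) t) has_fps_expansion fps_X * fps_deriv ?H"
    by (intro fps_expansion_intros laguerre_gf_coeffs)
  have 2: "(\<lambda>t. t * deriv (laguerre_gf \<alpha> x) t) holomorphic_on eball 0 (ereal 1)"
    unfolding eball_ereal by (intro holomorphic_intros laguerre_gf_holomorphic holomorphic_deriv) auto
  have "(\<lambda>n. fps_nth (fps_X * fps_deriv ?H) n * t ^ n) sums (t * deriv (laguerre_gf \<alpha> x) t)"
    using t by (intro has_fps_expansion_imp_sums_complex[OF 1 2]) auto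
  moreover have "fps_nth (fps_X * fps_deriv ?H) n = of_real (real n * poly (laguerre \<alpha> n) x)" for n
    by (cases n) (simp_all add: laguerre_gf_coeffs(2))
  ultimately show ?thesis
    by (simp only: DERIV_imp_deriv[OF laguerre_gf_has_derivative[OF t]]
        times_divide_eq_left times_divide_eq_right mult.assoc)
qed

text \<open>
  The exponential has an explicit modulus because \<open>t / (1 - t)\<close> has real part
  \<open>((1 - |t|\<^sup>2) / |1 - t|\<^sup>2 - 1) / 2\<close>.
\<close>

lemma norm_laguerre_gf_deriv:
  assumes t: "norm t < 1"
  defines "D \<equiv> (norm (1 - t))\<^sup>2"
  shows "(norm (t * (of_real (\<alpha> + 1) * (1 - t) - of_real x) / (1 - t)\<^sup>2 * laguerre_gf \<alpha> x t))\<^sup>2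
     = (norm t)\<^sup>2 * (norm (of_real (\<alpha> + 1) * (1 - t) - of_real x))\<^sup>2 * D powr (- \<alpha> - 3)
       * exp (x - x * (1 - (norm t)\<^sup>2) / D)"
proof -
  have t1: "1 - t \<noteq> 0" using t by auto
  then have D: "D > 0" by (simp add: D_def)
  have Re: "Re (t / (1 - t)) = ((1 - (norm t)\<^sup>2) / D - 1) / 2"
  proof -
    have D': "D = (1 - Re t)\<^sup>2 + (Im t)\<^sup>2" by (simp add: D_def cmod_power2)
    have "Re (t / (1 - t)) = (Re t * (1 - Re t) - Im t * Im t) / D"
      by (simp add: Re_divide D')
    also have "Re t * (1 - Re t) - Im t * Im t = Re t - (norm t)\<^sup>2"
      unfolding cmod_power2 by (simp add: algebra_simps power2_eq_square)
    finally have Re1: "Re (t / (1 - t)) = (Re t - (norm t)\<^sup>2) / D" .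
    have "D = 1 - 2 * Re t + (norm t)\<^sup>2"
      unfolding D' cmod_power2[of t] by (simp add: algebra_simps power2_eq_square)
    then have A: "Re t - (norm t)\<^sup>2 = ((1 - (norm t)\<^sup>2) - D) / 2"
      by simp
    have B: "(((1 - (norm t)\<^sup>2) - D) / 2) / D = ((1 - (norm t)\<^sup>2) / D - 1) / 2"
      using D by (simp add: field_simps)
    show ?thesis unfolding Re1 A B ..
  qed
  have expand: "2 * (- (u * (l / 2)) - x * ((q - 1) / 2)) = - u * l + (x - x * q)" for u l q
    by (simp add: field_simps)
  have LnD: "Re (Ln (1 - t)) = ln D / 2"
    using t1 by (simp add: D_def ln_realpow)
  have "norm (laguerre_gf \<alpha> x t) = exp (- ((\<alpha> + 1) * (ln D / 2)) - x * (((1 - (norm t)\<^sup>2) / D - 1) / 2))"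
    by (simp add: laguerre_gf_def flip: times_divide_eq_right) (simp only: LnD Re)
  then have "(norm (laguerre_gf \<alpha> x t))\<^sup>2 = exp (2 * (- ((\<alpha> + 1) * (ln D / 2)) - x * (((1 - (norm t)\<^sup>2) / D - 1) / 2)))"
    by (simp only: exp_double)
  also have "2 * (- ((\<alpha> + 1) * (ln D / 2)) - x * (((1 - (norm t)\<^sup>2) / D - 1) / 2))
      = - (\<alpha> + 1) * ln D + (x - x * (1 - (norm t)\<^sup>2) / D)"
    unfolding expand by simp
  also have "exp \<dots> = D powr (- (\<alpha> + 1)) * exp (x - x * (1 - (norm t)\<^sup>2) / D)"
    using D by (simp add: powr_def exp_add)
  finally have H2: "(norm (laguerre_gf \<alpha> x t))\<^sup>2 = D powr (- (\<alpha> + 1)) * exp (x - x * (1 - (norm t)\<^sup>2) / D)" .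
  have "D powr (- \<alpha> - 3) = D powr (- (\<alpha> + 1)) / D\<^sup>2"
    using powr_diff[of D "- (\<alpha> + 1)" 2] D by (simp add: algebra_simps)
  then show ?thesis
    unfolding norm_mult norm_divide power_mult_distrib power_divide H2
    by (simp add: norm_power D_def power_mult_distrib flip: power_mult)
qed

section \<open>The limiting integral and its majorant\<close>

text \<open>
  Substituting \<open>x / \<phi>\<^sup>2\<close> on each half-line gives Euler's integral for \<open>\<Gamma> (\<beta> - 1/2)\<close>.
\<close>

lemma integral_even_power_exp:
  fixes x \<beta> :: real
  assumes x: "x > 0" and \<beta>: "\<beta> > 1 / 2"
  shows "(\<integral>\<phi>. (\<phi>\<^sup>2) powr - \<beta> * exp (- (x / \<phi>\<^sup>2)) \<partial>lborel) = Gamma (\<beta> - 1 / 2) * x powr (1 / 2 - \<beta>)"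
proof -
  let ?f = "\<lambda>\<phi>::real. (\<phi>\<^sup>2) powr - \<beta> * exp (- (x / \<phi>\<^sup>2))"
  \<comment> \<open>After the substitution Euler's integrand is \<open>c\<close> times \<open>?f\<close>.\<close>
  define c where "c = 2 * x powr (\<beta> - 1 / 2)"
  have c: "c > 0" using x by (simp add: c_def)
  have half: "(?f has_integral Gamma (\<beta> - 1 / 2) / c) S"
    if S: "S \<in> sets lebesgue" and bij: "bij_betw (\<lambda>\<phi>. x / \<phi>\<^sup>2) S {0<..}" and nz: "0 \<notin> S" for S
  proof -
    have "((\<lambda>\<phi>. \<bar>- 2 * x / \<phi> ^ 3\<bar> * ((x / \<phi>\<^sup>2) powr (\<beta> - 1 / 2 - 1) * exp (- (x / \<phi>\<^sup>2)))) has_integral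
        Gamma (\<beta> - 1 / 2)) S"
    proof (rule Gamma_integral_substitution[OF _ S bij])
      fix u assume "u \<in> S"
      then have "u \<noteq> 0" using nz by auto
      then show "((\<lambda>\<phi>. x / \<phi>\<^sup>2) has_real_derivative - 2 * x / u ^ 3) (at u)"
        by (auto intro!: derivative_eq_intros simp: field_simps power2_eq_square power3_eq_cube)
    qed (use \<beta> in auto)
    then have "((\<lambda>\<phi>. c * ?f \<phi>) has_integral Gamma (\<beta> - 1 / 2)) S"
    proof (rule has_integral_eq[rotated])
      fix \<phi> assume "\<phi> \<in> S"
      then have p: "\<bar>\<phi>\<bar> > 0" using nz by auto
      have a: "\<bar>- 2 * x / \<phi> ^ 3\<bar> = 2 * x * \<bar>\<phi>\<bar> powr - 3"
        using x p by (simp add: abs_mult power_abs powr_minus divide_inverse flip: powr_numeral)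
      have b: "(x / \<phi>\<^sup>2) powr (\<beta> - 1 / 2 - 1) = x powr (\<beta> - 1 / 2 - 1) * \<bar>\<phi>\<bar> powr (- 2 * (\<beta> - 1 / 2 - 1))"
      proof -
        have "x / \<phi>\<^sup>2 = x * \<bar>\<phi>\<bar> powr - 2"
          using p by (simp add: powr_minus divide_inverse)
        then show ?thesis by (simp add: powr_mult powr_powr)
      qed
      have c': "(\<phi>\<^sup>2) powr - \<beta> = \<bar>\<phi>\<bar> powr (- 2 * \<beta>)"
      proof -
        have "\<phi>\<^sup>2 = \<bar>\<phi>\<bar> powr 2" using p by simp
        then show ?thesis by (simp only: powr_powr) simp
      qed
      have d: "\<bar>\<phi>\<bar> powr - 3 * \<bar>\<phi>\<bar> powr (- 2 * (\<beta> - 1 / 2 - 1)) = \<bar>\<phi>\<bar> powr (- 2 * \<beta>)"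
        by (simp flip: powr_add)
      have e: "x * x powr (\<beta> - 1 / 2 - 1) = x powr (\<beta> - 1 / 2)"
        using powr_add[of x 1 "\<beta> - 1 / 2 - 1"] x by simp
      show "\<bar>- 2 * x / \<phi> ^ 3\<bar> * ((x / \<phi>\<^sup>2) powr (\<beta> - 1 / 2 - 1) * exp (- (x / \<phi>\<^sup>2))) = c * ?f \<phi>"
        unfolding a b c' c_def d[symmetric] e[symmetric] by (simp only: mult_ac)
    qed
    from has_integral_mult_right[OF this, of "1 / c"] show ?thesis using c by simp
  qed
  have disj: "{0<..} \<inter> {..<0::real} = {}" by auto
  have "(?f has_integral Gamma (\<beta> - 1 / 2) / c) {0<..}"
  proof (rule half)
    show "bij_betw (\<lambda>\<phi>. x / \<phi>\<^sup>2) {0<..} {0<..}"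
      using x by (intro bij_betwI[of _ _ _ "\<lambda>u. sqrt (x / u)"]) auto
  qed auto
  moreover have "(?f has_integral Gamma (\<beta> - 1 / 2) / c) {..<0}"
  proof (rule half)
    show "bij_betw (\<lambda>\<phi>. x / \<phi>\<^sup>2) {..<0} {0<..}"
      using x by (intro bij_betwI[of _ _ _ "\<lambda>u. - sqrt (x / u)"]) auto
  qed auto
  ultimately have "(?f has_integral (Gamma (\<beta> - 1 / 2) / c + Gamma (\<beta> - 1 / 2) / c)) ({0<..} \<union> {..<0})"
    by (rule has_integral_Un) (simp only: disj negligible_empty)
  then have "(?f has_integral (Gamma (\<beta> - 1 / 2) / c + Gamma (\<beta> - 1 / 2) / c)) UNIV"
    by (rule iffD1[OF has_integral_spike_set_eq, rotated 2])
       (auto intro: negligible_subset[OF negligible_sing[of 0]])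
  also have "Gamma (\<beta> - 1 / 2) / c + Gamma (\<beta> - 1 / 2) / c = Gamma (\<beta> - 1 / 2) * x powr (1 / 2 - \<beta>)"
  proof -
    have e: "x powr (1 / 2 - \<beta>) = inverse (x powr (\<beta> - 1 / 2))"
      using powr_minus[of x "\<beta> - 1 / 2"] by (simp only: minus_diff_eq)
    have "g / (2 * X) + g / (2 * X) = g * inverse X" for g X :: real
      by (cases "X = 0") (simp_all add: field_simps)
    then show ?thesis unfolding c_def e .
  qed
  finally have I: "(?f has_integral Gamma (\<beta> - 1 / 2) * x powr (1 / 2 - \<beta>)) UNIV" .
  have m: "?f \<in> borel_measurable borel" by measurable
  have nn: "(\<integral>\<^sup>+ \<phi>. ennreal (?f \<phi>) \<partial>lborel) = ennreal (Gamma (\<beta> - 1 / 2) * x powr (1 / 2 - \<beta>))"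
    by (rule nn_integral_has_integral_lborel[OF m _ I]) auto
  have "Gamma (\<beta> - 1 / 2) > 0" using \<beta> by (intro Gamma_real_pos) auto
  with nn_integral_eq_integrable[THEN iffD1, OF _ _ _ nn] m x show ?thesis
    by (simp add: less_imp_le)
qed

text \<open>
  The radius is \<open>exp (- s / 2)\<close>, not \<open>exp (- s)\<close>, because Parseval's identity squares it.
\<close>

definition circle_dist2 :: "real \<Rightarrow> real \<Rightarrow> real" where
  "circle_dist2 s \<theta> = (norm (1 - of_real (exp (- s / 2)) * cis \<theta>))\<^sup>2"

lemma circle_dist2_eq: "circle_dist2 s \<theta> = (1 - exp (- s / 2))\<^sup>2 + 4 * exp (- s / 2) * (sin (\<theta> / 2))\<^sup>2"
proof -
  have expand: "(1 - r * c)\<^sup>2 + (r * d)\<^sup>2 = 1 - 2 * r * c + r\<^sup>2 * (c\<^sup>2 + d\<^sup>2)" for r c d :: real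
    by (simp add: power2_eq_square algebra_simps)
  have "circle_dist2 s \<theta> = 1 - 2 * exp (- s / 2) * cos \<theta> + (exp (- s / 2))\<^sup>2 * ((cos \<theta>)\<^sup>2 + (sin \<theta>)\<^sup>2)"
    unfolding circle_dist2_def cmod_power2 expand[symmetric] by simp
  also have "\<dots> = 1 - 2 * exp (- s / 2) * cos \<theta> + (exp (- s / 2))\<^sup>2" by simp
  also have "cos \<theta> = 1 - 2 * (sin (\<theta> / 2))\<^sup>2"
    using cos_double_sin[of "\<theta> / 2"] by simp
  finally show ?thesis by (simp add: power2_eq_square algebra_simps)
qed

lemma circle_dist2_pos: "s > 0 \<Longrightarrow> circle_dist2 s \<theta> > 0"
  unfolding circle_dist2_eq by (intro add_pos_nonneg) auto

text \<open>
  By concavity of the sine (Jordan's inequality).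
\<close>

lemma circle_dist2_lower:
  assumes "0 < s" "s \<le> 1" "\<bar>\<theta>\<bar> \<le> pi"
  shows "circle_dist2 s \<theta> \<ge> 4 * exp (- 1 / 2) / pi\<^sup>2 * \<theta>\<^sup>2"
proof -
  have sin_lower: "sin (y / 2) \<ge> y / pi" if "0 \<le> y" "y \<le> pi" for y :: real
  proof -
    have "convex_on {0..pi / 2} (\<lambda>x. - sin x)"
      by (rule f''_ge0_imp_convex[of _ _ "\<lambda>x. - cos x" "\<lambda>x. sin x"])
         (auto intro!: derivative_eq_intros sin_ge_zero)
    from convex_onD_Icc'[OF this, of "y / 2"] that show ?thesis
      by (simp add: field_simps)
  qed
  have "(\<theta> / pi)\<^sup>2 \<le> (sin (\<theta> / 2))\<^sup>2"
  proof -
    have "(\<bar>\<theta>\<bar> / pi)\<^sup>2 \<le> (sin (\<bar>\<theta>\<bar> / 2))\<^sup>2"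
      using sin_lower[of "\<bar>\<theta>\<bar>"] assms by (intro power_mono) auto
    then show ?thesis by (cases "\<theta> \<ge> 0") (auto simp: power_divide)
  qed
  then have "4 * exp (- 1 / 2) * (\<theta> / pi)\<^sup>2 \<le> 4 * exp (- s / 2) * (sin (\<theta> / 2))\<^sup>2"
    using assms by (intro mult_mono) auto
  also have "\<dots> \<le> circle_dist2 s \<theta>" unfolding circle_dist2_eq by simp
  finally show ?thesis by (simp add: power_divide)
qed

lemma circle_dist2_tendsto: "((\<lambda>s. circle_dist2 s (sqrt s * \<phi>) / s) \<longlongrightarrow> \<phi>\<^sup>2) (at_right 0)"
proof -
  consider "\<phi> > 0" | "\<phi> = 0" | "\<phi> < 0" by linarith
  then show ?thesis
  proof cases
    case 1
    then show ?thesis unfolding circle_dist2_eq by real_asymp (simp add: power2_eq_square)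
  next
    case 2
    have "((\<lambda>s::real. (1 - exp (- s / 2))\<^sup>2 / s) \<longlongrightarrow> 0) (at_right 0)" by real_asymp
    then show ?thesis unfolding circle_dist2_eq 2 by simp
  next
    case 3
    then show ?thesis unfolding circle_dist2_eq by real_asymp (simp add: power2_eq_square)
  qed
qed

text \<open>
  With \<open>y = k / (v \<beta>)\<close> this is the inequality \<open>y \<le> exp y\<close> raised to the power \<open>\<beta>\<close>.
\<close>

lemma powr_neg_exp_bound:
  fixes v \<beta> k :: real
  assumes "v > 0" "\<beta> > 0" "k > 0"
  shows "v powr - \<beta> * exp (- (k / v)) \<le> (\<beta> / k) powr \<beta>"
proof -
  have "k / (v * \<beta>) \<le> exp (k / (v * \<beta>))" using exp_ge_add_one_self[of "k / (v * \<beta>)"] by linarith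
  then have "(k / (v * \<beta>)) powr \<beta> \<le> exp (k / (v * \<beta>)) powr \<beta>"
    using assms by (intro powr_mono2) auto
  also have "\<dots> = exp (k / v)" using assms by (simp add: exp_powr_real)
  finally have "(\<beta> / k) powr \<beta> * (k / (v * \<beta>)) powr \<beta> \<le> (\<beta> / k) powr \<beta> * exp (k / v)"
    by (intro mult_left_mono) auto
  also have "(\<beta> / k) powr \<beta> * (k / (v * \<beta>)) powr \<beta> = v powr - \<beta>"
    using assms by (simp add: powr_mult[symmetric] powr_minus inverse_powr[symmetric] field_simps)
  finally show ?thesis by (simp add: exp_minus field_simps)
qed

text \<open>
  Near \<open>\<phi> = 0\<close> the exponential beats the negative power of \<open>v\<close>; away from it the power alone decays
  at least as fast as \<open>\<phi>\<^bsup>-2\<^esup>\<close>.  The right-hand side does not involve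
  \<open>v\<close>, so it serves as one majorant for a whole family of rescaled integrands.
\<close>

lemma kernel_dominated:
  fixes v \<phi> \<beta> k c :: real
  assumes "v \<ge> c * \<phi>\<^sup>2" "v > 0" "c > 0" "\<beta> \<ge> 1" "k > 0"
  shows "v powr - \<beta> * exp (- (k / v)) \<le> (2 * (\<beta> / k) powr \<beta> + 2 * c powr - \<beta>) * inverse (1 + \<phi>\<^sup>2)"
proof -
  let ?M = "(\<beta> / k) powr \<beta>" and ?i = "inverse (1 + \<phi>\<^sup>2)"
  have i: "?i \<ge> 0" by simp
  show ?thesis
  proof (cases "\<phi>\<^sup>2 \<le> 1")
    case True
    then have "1 / 2 \<le> ?i" by (simp add: field_simps add_pos_nonneg)
    then have "?M * 1 \<le> ?M * (2 * ?i)" by (intro mult_left_mono) auto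
    moreover have "v powr - \<beta> * exp (- (k / v)) \<le> ?M"
      using assms by (intro powr_neg_exp_bound) auto
    moreover have "0 \<le> 2 * c powr - \<beta> * ?i" using i by simp
    ultimately show ?thesis by (simp only: distrib_right)
  next
    case False
    have "v powr - \<beta> * exp (- (k / v)) \<le> v powr - \<beta> * 1"
      using assms by (intro mult_left_mono) auto
    also have "\<dots> \<le> (c * \<phi>\<^sup>2) powr - \<beta>"
    proof -
      have "c * \<phi>\<^sup>2 > 0" using assms False by (intro mult_pos_pos) linarith+
      with assms show ?thesis using powr_mono2'[of "- \<beta>" "c * \<phi>\<^sup>2" v] by simp
    qed
    also have "\<dots> = c powr - \<beta> * (\<phi>\<^sup>2) powr - \<beta>" by (rule powr_mult)
    also have "\<dots> \<le> c powr - \<beta> * (\<phi>\<^sup>2) powr - 1"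
      using assms False by (intro mult_left_mono powr_mono) auto
    also have "\<dots> = c powr - \<beta> * inverse (\<phi>\<^sup>2)" by (simp add: powr_minus)
    also have "\<dots> \<le> c powr - \<beta> * (2 * ?i)"
    proof (rule mult_left_mono)
      have "1 + \<phi>\<^sup>2 \<le> 2 * \<phi>\<^sup>2" "\<phi>\<^sup>2 > 0" using False by auto
      then show "inverse (\<phi>\<^sup>2) \<le> 2 * ?i" by (simp add: field_simps add_pos_pos)
    qed auto
    finally have "v powr - \<beta> * exp (- (k / v)) \<le> c powr - \<beta> * (2 * ?i)" .
    moreover have "0 \<le> 2 * ?M * ?i" using i by simp
    ultimately show ?thesis by (simp only: distrib_right)
  qed
qed

section \<open>Asymptotics of the Laguerre tails\<close>

text \<open>
  The Abel sum is a mean over the circle of radius \<open>exp (- s / 2)\<close>.  Its integrand \<open>G s\<close> concentrates where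
  \<open>|1 - t|\<^sup>2\<close> is comparable to \<open>1 - |t|\<^sup>2\<close>, that is, at angles of order \<open>sqrt s\<close>.  In the variable
  \<open>\<phi> = \<theta> / sqrt s\<close> the powers of \<open>s\<close> cancel exactly: \<open>|1 - t|\<^sup>2 / s\<close> tends to \<open>\<phi>\<^sup>2\<close> and
  \<open>(1 - |t|\<^sup>2) / s\<close> to 1.
\<close>

theorem laguerre_abel_asymptotics:
  fixes \<alpha> x :: real
  assumes \<alpha>: "\<alpha> > - 1" and x: "x > 0"
  defines "a \<equiv> \<lambda>n. (real n * poly (laguerre \<alpha> n) x)\<^sup>2"
  shows "\<And>s. s > 0 \<Longrightarrow> summable (\<lambda>n. a n * exp (- s * real n))"
    and "((\<lambda>s. s powr (\<alpha> + 5 / 2) * (\<Sum>n. a n * exp (- s * real n)))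
            \<longlongrightarrow> exp x * Gamma (\<alpha> + 5 / 2) * x powr (- \<alpha> - 1 / 2) / (2 * pi)) (at_right 0)"
proof -
  define K where "K s \<theta> = (norm (of_real (\<alpha> + 1) * (1 - of_real (exp (- s / 2)) * cis \<theta>) - of_real x))\<^sup>2" for s \<theta>
  define G where "G s \<theta> = exp (- s) * K s \<theta> * circle_dist2 s \<theta> powr (- \<alpha> - 3)
      * exp (x - x * (1 - exp (- s)) / circle_dist2 s \<theta>)" for s \<theta>
  define V where "V s \<phi> = circle_dist2 s (sqrt s * \<phi>) / s" for s \<phi>
  define Q where "Q s \<phi> = exp (- s) * K s (sqrt s * \<phi>) * V s \<phi> powr (- \<alpha> - 3)
      * exp (x - x * ((1 - exp (- s)) / s) / V s \<phi>)" for s \<phi>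
  define J where "J s = (\<lambda>\<phi>. indicator {-pi..pi} (sqrt s * \<phi>) * Q s \<phi>)" for s
  define J0 where "J0 \<phi> = x\<^sup>2 * exp x * ((\<phi>\<^sup>2) powr - (\<alpha> + 3) * exp (- (x / \<phi>\<^sup>2)))" for \<phi>
  have sums: "(\<lambda>n. a n * exp (- s * real n)) sums
      ((\<integral>\<theta>. indicator {-pi..pi} \<theta> * G s \<theta> \<partial>lborel) / (2 * pi))" if s: "s > 0" for s
  proof -
    define r where "r = exp (- s / 2)"
    have r: "0 < r" "r < 1" using s by (auto simp: r_def)
    define c where "c n = complex_of_real (real n * poly (laguerre \<alpha> n) x)" for n
    define F where "F \<theta> = (let t = of_real r * cis \<theta> in
       t * (of_real (\<alpha> + 1) * (1 - t) - of_real x) / (1 - t)\<^sup>2 * laguerre_gf \<alpha> x t)" for \<theta>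
    have t: "norm (of_real r * cis \<theta>) = r" for \<theta> using r by (simp add: norm_mult)
    have csum: "(\<lambda>n. c n * (of_real r * cis \<theta>) ^ n) sums F \<theta>" for \<theta>
      unfolding c_def F_def Let_def using r by (intro laguerre_gf_deriv_sums) (simp only: t)
    have "summable (\<lambda>n. norm (c n * (of_real r) ^ n))"
    proof (rule powser_insidea)
      show "summable (\<lambda>n. c n * of_real ((1 + r) / 2) ^ n)"
        unfolding c_def using r by (intro sums_summable[OF laguerre_gf_deriv_sums]) (simp only: norm_of_real, simp)
      show "norm (of_real r :: complex) < norm (of_real ((1 + r) / 2) :: complex)"
        using r by (simp only: norm_of_real) simp
    qed
    then have sm: "summable (\<lambda>n. norm (c n) * r ^ n)"
      using r by (simp add: norm_mult norm_power)
    have "(norm (F \<theta>))\<^sup>2 = G s \<theta>" for \<theta>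
    proof -
      have "(norm (F \<theta>))\<^sup>2 = r\<^sup>2 * K s \<theta> * circle_dist2 s \<theta> powr (- \<alpha> - 3)
          * exp (x - x * (1 - r\<^sup>2) / circle_dist2 s \<theta>)"
        unfolding F_def Let_def using norm_laguerre_gf_deriv[of "of_real r * cis \<theta>" \<alpha> x] t[of \<theta>] r
        by (simp only: K_def circle_dist2_def r_def)
      moreover have "r\<^sup>2 = exp (- s)" by (simp add: r_def flip: exp_double)
      ultimately show ?thesis by (simp only: G_def)
    qed
    moreover have "(norm (c n))\<^sup>2 * r ^ (2 * n) = a n * exp (- s * real n)" for n
    proof -
      have "r ^ (2 * n) = exp (- s * real n)"
        using exp_of_nat_mult[of "2 * n" "- s / 2"] by (simp add: r_def mult.commute)
      moreover have "(norm (c n))\<^sup>2 = a n" unfolding c_def a_def norm_of_real by simp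
      ultimately show ?thesis by simp
    qed
    ultimately show ?thesis
      using parseval_circle[OF less_imp_le[OF r(1)] sm csum] by simp
  qed
  then show "summable (\<lambda>n. a n * exp (- s * real n))" if "s > 0" for s
    using that by (auto simp: sums_iff)
  have scale: "s powr (\<alpha> + 5 / 2) * (\<Sum>n. a n * exp (- s * real n)) = (\<integral>\<phi>. J s \<phi> \<partial>lborel) / (2 * pi)"
    if s: "s > 0" for s
  proof -
    have "(\<integral>\<theta>. indicator {-pi..pi} \<theta> * G s \<theta> \<partial>lborel)
        = sqrt s * (\<integral>\<phi>. indicator {-pi..pi} (sqrt s * \<phi>) * G s (sqrt s * \<phi>) \<partial>lborel)"
      using lborel_integral_real_affine[of "sqrt s" "\<lambda>\<theta>. indicator {-pi..pi} \<theta> * G s \<theta>" 0] s by simp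
    moreover have "s powr (\<alpha> + 5 / 2) * sqrt s * (indicator {-pi..pi} (sqrt s * \<phi>) * G s (sqrt s * \<phi>)) = J s \<phi>" for \<phi>
    proof -
      let ?D = "circle_dist2 s (sqrt s * \<phi>)"
      have e1: "s powr (\<alpha> + 5 / 2) * sqrt s = s powr (\<alpha> + 3)"
        using powr_add[of s "\<alpha> + 5 / 2" "1 / 2"] s by (simp add: powr_half_sqrt add.commute)
      have e2: "s powr (\<alpha> + 3) * ?D powr (- \<alpha> - 3) = V s \<phi> powr (- \<alpha> - 3)"
        using powr_minus[of s "\<alpha> + 3"] s circle_dist2_pos[OF s]
        by (simp add: V_def powr_divide less_imp_le field_simps)
      have e3: "x * (1 - exp (- s)) / ?D = x * ((1 - exp (- s)) / s) / V s \<phi>"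
        using s by (simp add: V_def)
      show ?thesis
        unfolding J_def Q_def G_def e3 e2[symmetric] e1[symmetric] by (simp only: mult_ac)
    qed
    ultimately have "s powr (\<alpha> + 5 / 2) * (\<integral>\<theta>. indicator {-pi..pi} \<theta> * G s \<theta> \<partial>lborel) = (\<integral>\<phi>. J s \<phi> \<partial>lborel)"
      by (simp only: mult.assoc flip: integral_mult_right_zero)
    then show ?thesis
      unfolding sums_unique[OF sums[OF s], symmetric] by (simp only: times_divide_eq_right)
  qed
  have Kbound: "K s \<theta> \<le> (2 * \<bar>\<alpha> + 1\<bar> + x)\<^sup>2" if "s > 0" for s \<theta>
  proof -
    have *: "norm (complex_of_real b * (1 - u) - of_real x) \<le> 2 * \<bar>b\<bar> + x" if "norm u \<le> 1" for b u
    proof -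
      have "norm (1 - u) \<le> 2" using norm_triangle_ineq4[of 1 u] that by simp
      then have "norm (complex_of_real b * (1 - u)) \<le> \<bar>b\<bar> * 2"
        unfolding norm_mult norm_of_real by (intro mult_left_mono) auto
      then show ?thesis
        using norm_triangle_ineq4[of "complex_of_real b * (1 - u)" "of_real x"] x by simp
    qed
    show ?thesis
      unfolding K_def using that by (intro power_mono *) (simp_all add: norm_mult)
  qed
  \<comment> \<open>\<open>c0\<close> is the constant of \<open>circle_dist2_lower\<close>; the exponential is bounded through
    \<open>(1 - exp (- s)) / s \<ge> 1 / 2\<close>, whence the parameter \<open>x / 2\<close> in \<open>B\<close>.\<close>
  define c0 where "c0 = 4 * exp (- 1 / 2) / pi\<^sup>2"
  define B where "B = (2 * \<bar>\<alpha> + 1\<bar> + x)\<^sup>2 * exp x * (2 * ((\<alpha> + 3) / (x / 2)) powr (\<alpha> + 3) + 2 * c0 powr - (\<alpha> + 3))"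
  have Jbound: "norm (J s \<phi>) \<le> B * inverse (1 + \<phi>\<^sup>2)" if s: "0 < s" "s \<le> 1" for s \<phi>
  proof (cases "\<bar>sqrt s * \<phi>\<bar> \<le> pi")
    case False
    have "B \<ge> 0" unfolding B_def by (intro mult_nonneg_nonneg add_nonneg_nonneg) auto
    moreover have "J s \<phi> = 0" using False by (auto simp: J_def indicator_def abs_le_iff)
    ultimately show ?thesis by simp
  next
    case True
    have V: "V s \<phi> > 0" using circle_dist2_pos[of s] s by (simp add: V_def)
    have Vl: "V s \<phi> \<ge> c0 * \<phi>\<^sup>2"
      using circle_dist2_lower[OF s True] s by (simp add: V_def c0_def power_mult_distrib field_simps)
    have kappa: "(1 - exp (- s)) / s \<ge> 1 / 2"
    proof -
      have "exp (- s) \<le> inverse (1 + s)"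
        unfolding exp_minus using s by (intro le_imp_inverse_le exp_ge_add_one_self) auto
      moreover have "inverse (1 + s) \<le> 1 - s / 2"
      proof -
        have "s * s \<le> s * 1" using s by (intro mult_left_mono) auto
        then have "1 \<le> (1 - s / 2) * (1 + s)" by (simp add: algebra_simps)
        then show ?thesis using s by (simp add: inverse_eq_divide divide_le_eq)
      qed
      ultimately have "s / 2 \<le> 1 - exp (- s)" by linarith
      then show ?thesis using s by (simp add: le_divide_eq)
    qed
    have "exp (x - x * ((1 - exp (- s)) / s) / V s \<phi>) \<le> exp (x - x / 2 / V s \<phi>)"
    proof -
      have "x * (1 / 2) / V s \<phi> \<le> x * ((1 - exp (- s)) / s) / V s \<phi>"
        using V x kappa by (intro divide_right_mono mult_left_mono) auto
      then show ?thesis by simp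
    qed
    also have "\<dots> = exp x * exp (- (x / 2 / V s \<phi>))" by (simp flip: exp_add)
    finally have e: "exp (x - x * ((1 - exp (- s)) / s) / V s \<phi>) \<le> exp x * exp (- (x / 2 / V s \<phi>))" .
    have Q0: "Q s \<phi> \<ge> 0" unfolding Q_def K_def by (intro mult_nonneg_nonneg) auto
    have "Q s \<phi> \<le> 1 * (2 * \<bar>\<alpha> + 1\<bar> + x)\<^sup>2 * V s \<phi> powr (- \<alpha> - 3) * (exp x * exp (- (x / 2 / V s \<phi>)))"
      unfolding Q_def using s by (intro mult_mono Kbound e) (auto simp: K_def)
    also have "\<dots> = (2 * \<bar>\<alpha> + 1\<bar> + x)\<^sup>2 * exp x * (V s \<phi> powr - (\<alpha> + 3) * exp (- (x / 2 / V s \<phi>)))"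
      by (simp add: mult_ac)
    also have "\<dots> \<le> (2 * \<bar>\<alpha> + 1\<bar> + x)\<^sup>2 * exp x *
        ((2 * ((\<alpha> + 3) / (x / 2)) powr (\<alpha> + 3) + 2 * c0 powr - (\<alpha> + 3)) * inverse (1 + \<phi>\<^sup>2))"
      using \<alpha> x by (intro mult_left_mono kernel_dominated[OF Vl V]) (auto simp: c0_def)
    finally have "Q s \<phi> \<le> B * inverse (1 + \<phi>\<^sup>2)" by (simp only: B_def mult.assoc)
    moreover have "J s \<phi> = Q s \<phi>" using True by (auto simp: J_def indicator_def abs_le_iff)
    ultimately show ?thesis using Q0 by simp
  qed
  have Jlim: "((\<lambda>s. J s \<phi>) \<longlongrightarrow> J0 \<phi>) (at_right 0)" if \<phi>: "\<phi> \<noteq> 0" for \<phi>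
  proof -
    have Vlim: "((\<lambda>s. V s \<phi>) \<longlongrightarrow> \<phi>\<^sup>2) (at_right 0)"
      unfolding V_def by (rule circle_dist2_tendsto)
    have s0: "((\<lambda>s::real. s) \<longlongrightarrow> 0) (at_right 0)" by (rule tendsto_ident_at)
    \<comment> \<open>The factor \<open>K\<close> tends to \<open>x\<^sup>2\<close>, since \<open>|1 - t|\<^sup>2 = s V s \<phi>\<close> tends to 0.\<close>
    have d0: "((\<lambda>s. 1 - of_real (exp (- s / 2)) * cis (sqrt s * \<phi>)) \<longlongrightarrow> 0) (at_right 0)"
    proof -
      have "((\<lambda>s. sqrt (s * V s \<phi>)) \<longlongrightarrow> sqrt (0 * \<phi>\<^sup>2)) (at_right 0)"
        by (intro tendsto_real_sqrt tendsto_mult s0 Vlim)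
      moreover have "\<forall>\<^sub>F s in at_right 0. sqrt (s * V s \<phi>) = norm (1 - of_real (exp (- s / 2)) * cis (sqrt s * \<phi>))"
        using eventually_at_right_less[of 0] by eventually_elim (simp add: V_def circle_dist2_def)
      ultimately have "((\<lambda>s. norm (1 - of_real (exp (- s / 2)) * cis (sqrt s * \<phi>))) \<longlongrightarrow> 0) (at_right 0)"
        by (simp add: tendsto_cong)
      then show ?thesis by (rule tendsto_norm_zero_cancel)
    qed
    have Klim: "((\<lambda>s. K s (sqrt s * \<phi>)) \<longlongrightarrow> x\<^sup>2) (at_right 0)"
    proof -
      have "((\<lambda>s. K s (sqrt s * \<phi>)) \<longlongrightarrow> (norm (of_real (\<alpha> + 1) * 0 - complex_of_real x))\<^sup>2) (at_right 0)"
        unfolding K_def by (intro tendsto_intros d0)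
      then show ?thesis by simp
    qed
    have klim: "((\<lambda>s::real. (1 - exp (- s)) / s) \<longlongrightarrow> 1) (at_right 0)" by real_asymp
    have "((\<lambda>s. Q s \<phi>) \<longlongrightarrow> exp (- 0) * x\<^sup>2 * (\<phi>\<^sup>2) powr (- \<alpha> - 3) * exp (x - x * 1 / \<phi>\<^sup>2)) (at_right 0)"
      unfolding Q_def using \<phi> by (intro tendsto_intros s0 Klim Vlim klim) auto
    also have "exp (- 0) * x\<^sup>2 * (\<phi>\<^sup>2) powr (- \<alpha> - 3) * exp (x - x * 1 / \<phi>\<^sup>2) = J0 \<phi>"
    proof -
      have "- \<alpha> - 3 = - (\<alpha> + 3)" by simp
      then show ?thesis by (simp add: J0_def exp_diff exp_minus divide_inverse mult_ac)
    qed
    finally have Qlim: "((\<lambda>s. Q s \<phi>) \<longlongrightarrow> J0 \<phi>) (at_right 0)" .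
    have "((\<lambda>s. \<bar>sqrt s * \<phi>\<bar>) \<longlongrightarrow> \<bar>sqrt 0 * \<phi>\<bar>) (at_right 0)"
      by (intro tendsto_intros s0)
    then have "eventually (\<lambda>s. \<bar>sqrt s * \<phi>\<bar> < pi) (at_right 0)"
      by (rule order_tendstoD) simp
    then have "eventually (\<lambda>s. Q s \<phi> = J s \<phi>) (at_right 0)"
      by eventually_elim (auto simp: J_def indicator_def abs_less_iff)
    from Lim_transform_eventually[OF Qlim this] show ?thesis .
  qed
  have Jm: "J s \<in> borel_measurable lborel" for s
  proof -
    have [measurable]: "(\<lambda>\<phi>. cis (sqrt s * \<phi>)) \<in> borel_measurable borel"
      by (intro borel_measurable_continuous_onI continuous_intros)
    show ?thesis
      unfolding J_def Q_def V_def K_def circle_dist2_def by measurable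
  qed
  have J0m: "J0 \<in> borel_measurable lborel"
    unfolding J0_def by measurable
  have "((\<lambda>T. \<integral>\<phi>. J (inverse T) \<phi> \<partial>lborel) \<longlongrightarrow> (\<integral>\<phi>. J0 \<phi> \<partial>lborel)) at_top"
  proof (rule integral_dominated_convergence_at_top[where w = "\<lambda>\<phi>. B * inverse (1 + \<phi>\<^sup>2)"])
    show "integrable lborel (\<lambda>\<phi>. B * inverse (1 + \<phi>\<^sup>2))"
      using integrable_inverse_1_plus_square by (simp add: set_integrable_def)
    have "((\<lambda>T. J (inverse T) \<phi>) \<longlongrightarrow> J0 \<phi>) at_top" if "\<phi> \<noteq> 0" for \<phi>
      using Jlim[OF that] by (simp add: filterlim_at_right_to_top)
    then show "AE \<phi> in lborel. ((\<lambda>T. J (inverse T) \<phi>) \<longlongrightarrow> J0 \<phi>) at_top"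
      using AE_lborel_singleton[of 0] by (auto elim!: eventually_mono)
    show "\<forall>\<^sub>F T in at_top. AE \<phi> in lborel. norm (J (inverse T) \<phi>) \<le> B * inverse (1 + \<phi>\<^sup>2)"
      using eventually_ge_at_top[of "1::real"]
      by eventually_elim (intro AE_I2 Jbound, auto simp: field_simps)
  qed (use J0m Jm in auto)
  then have lim: "((\<lambda>s. \<integral>\<phi>. J s \<phi> \<partial>lborel) \<longlongrightarrow> (\<integral>\<phi>. J0 \<phi> \<partial>lborel)) (at_right 0)"
    by (simp add: filterlim_at_right_to_top)
  have "(\<integral>\<phi>. J0 \<phi> \<partial>lborel) = x\<^sup>2 * exp x * (Gamma (\<alpha> + 3 - 1 / 2) * x powr (1 / 2 - (\<alpha> + 3)))"
    unfolding J0_def integral_mult_right_zero using \<alpha> x by (subst integral_even_power_exp) auto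
  also have "\<dots> = exp x * Gamma (\<alpha> + 5 / 2) * x powr (- \<alpha> - 1 / 2)"
  proof -
    have e1: "x\<^sup>2 * x powr (1 / 2 - (\<alpha> + 3)) = x powr (- \<alpha> - 1 / 2)"
    proof -
      have h: "- \<alpha> - 1 / 2 = 2 + (1 / 2 - (\<alpha> + 3))" by simp
      show ?thesis unfolding h powr_add using x by simp
    qed
    have e2: "\<alpha> + 3 - 1 / 2 = \<alpha> + 5 / 2" by simp
    show ?thesis unfolding e1[symmetric] e2 by (simp only: mult_ac)
  qed
  finally have J0I: "(\<integral>\<phi>. J0 \<phi> \<partial>lborel) = exp x * Gamma (\<alpha> + 5 / 2) * x powr (- \<alpha> - 1 / 2)" .
  have "((\<lambda>s. (\<integral>\<phi>. J s \<phi> \<partial>lborel) / (2 * pi)) \<longlongrightarrow>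
      exp x * Gamma (\<alpha> + 5 / 2) * x powr (- \<alpha> - 1 / 2) / (2 * pi)) (at_right 0)"
    using lim unfolding J0I by (intro tendsto_divide tendsto_const) auto
  moreover have "\<forall>\<^sub>F s in at_right 0. (\<integral>\<phi>. J s \<phi> \<partial>lborel) / (2 * pi)
      = s powr (\<alpha> + 5 / 2) * (\<Sum>n. a n * exp (- s * real n))"
    using eventually_at_right_less[of 0] by eventually_elim (simp only: scale)
  ultimately show "((\<lambda>s. s powr (\<alpha> + 5 / 2) * (\<Sum>n. a n * exp (- s * real n)))
            \<longlongrightarrow> exp x * Gamma (\<alpha> + 5 / 2) * x powr (- \<alpha> - 1 / 2) / (2 * pi)) (at_right 0)"
    by (rule Lim_transform_eventually)
qed

text \<open>
  Euler's limit formula for \<open>\<Gamma> (\<alpha> + 1)\<close>, with the Pochhammer symbol in it written as a quotient of Gamma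
  values.
\<close>

lemma Gamma_quotient_tendsto:
  fixes \<alpha> :: real
  assumes \<alpha>: "\<alpha> > - 1"
  shows "(\<lambda>n. real n powr (\<alpha> + 1) * Gamma (real n) / Gamma (real n + \<alpha> + 1)) \<longlonglongrightarrow> 1"
proof -
  define z where "z = \<alpha> + 1"
  have z: "z > 0" using \<alpha> by (simp add: z_def)
  then have Gz: "Gamma z > 0" by simp
  have "(\<lambda>n. Gamma_series z n / Gamma z * ((real n + z) / real n)) \<longlonglongrightarrow> Gamma z / Gamma z * 1"
    using Gz by (intro tendsto_mult tendsto_divide Gamma_series_LIMSEQ tendsto_const) (auto, real_asymp)
  moreover have "\<forall>\<^sub>F n in sequentially. Gamma_series z n / Gamma z * ((real n + z) / real n)
      = real n powr (\<alpha> + 1) * Gamma (real n) / Gamma (real n + \<alpha> + 1)"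
    using eventually_gt_at_top[of 0]
  proof eventually_elim
    case (elim n)
    have nz: "w \<notin> \<int>\<^sub>\<le>\<^sub>0" if "w > 0" for w :: real
      using that nonpos_Ints_nonpos[of w] by linarith
    have "pochhammer z (n + 1) = Gamma (z + real (n + 1)) / Gamma z"
      using pochhammer_Gamma[of z "n + 1"] nz[OF z] by simp
    also have "Gamma (z + real (n + 1)) = (real n + z) * Gamma (real n + z)"
      using Gamma_plus1[of "real n + z"] nz[of "real n + z"] z by (simp add: add_ac)
    finally have p: "pochhammer z (n + 1) = (real n + z) * Gamma (real n + z) / Gamma z" .
    have f: "fact n = real n * Gamma (real n)"
      using Gamma_fact[of n, where 'a = real] Gamma_plus1[of "real n"] nz[of "real n"] elim by (simp add: add_ac)
    have "Gamma_series z n = fact n * real n powr z / pochhammer z (n + 1)"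
      using elim by (simp add: Gamma_series_def powr_def)
    also have "\<dots> / Gamma z * ((real n + z) / real n) = real n powr z * Gamma (real n) / Gamma (real n + z)"
    proof -
      have "real n + z \<noteq> 0" "real n \<noteq> 0" using elim z by auto
      then show ?thesis unfolding p f using Gz by simp
    qed
    finally show ?case by (simp add: z_def add.assoc)
  qed
  ultimately show ?thesis using Gz by (simp add: tendsto_cong)
qed

context
  fixes \<alpha> :: real and L :: "nat \<Rightarrow> real poly"
  assumes \<alpha>: "\<alpha> > - 1" and L: "assoc_laguerre_polys \<alpha> L"
begin

lemma laguerre_term_diagonal:
  assumes x: "x > 0"
  shows "summable (\<lambda>k. laguerre_term \<alpha> L x x (N + 1 + k))"
    and "(\<lambda>N. sqrt (real N) * (\<Sum>k. laguerre_term \<alpha> L x x (N + 1 + k)))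
              \<longlonglongrightarrow> x powr (- \<alpha> - 1 / 2) * exp x / pi"
proof -
  define a where "a n = (real n * poly (laguerre \<alpha> n) x)\<^sup>2" for n
  define \<rho> where "\<rho> = \<alpha> + 5 / 2"
  define \<sigma> where "\<sigma> = \<alpha> + 3"
  have \<rho>: "0 < \<rho>" "\<rho> < \<sigma>" and \<sigma>\<rho>: "\<sigma> - \<rho> = 1 / 2" using \<alpha> by (auto simp: \<rho>_def \<sigma>_def)
  define C where "C = exp x * Gamma \<rho> * x powr (- \<alpha> - 1 / 2) / (2 * pi)"
  have A1: "summable (\<lambda>n. a n * exp (- s * real n))" if "s > 0" for s
    unfolding a_def by (rule laguerre_abel_asymptotics(1)[OF \<alpha> x that])
  have A2: "((\<lambda>s. s powr \<rho> * (\<Sum>n. a n * exp (- s * real n))) \<longlongrightarrow> C) (at_right 0)"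
    unfolding a_def \<rho>_def C_def by (rule laguerre_abel_asymptotics(2)[OF \<alpha> x])
  have a0: "a n \<ge> 0" for n by (simp add: a_def)
  have "(\<lambda>N. (\<Sum>n\<le>N. a n) / real N powr \<rho>) \<longlonglongrightarrow> C / Gamma (\<rho> + 1)"
    by (rule karamata_tauberian[OF a0 \<rho>(1) A1 A2])
  note R = regular_tail_of_partial_sums[OF a0 \<rho> this]
  have S: "sqrt (real N) = real N powr (\<sigma> - \<rho>)" for N
    unfolding \<sigma>\<rho> by (simp add: powr_half_sqrt)
  define c where "c n = real n powr (\<alpha> + 1) * Gamma (real n) / Gamma (real n + \<alpha> + 1)" for n
  note W = tail_tendsto_weighted[OF _ R(1) powr_ge_zero Gamma_quotient_tendsto[OF \<alpha>, folded c_def] R(2)]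
  \<comment> \<open>\<open>a n\<close> contains the factor \<open>n\<^sup>2\<close>, and \<open>(\<alpha> + 1) - \<sigma> + 2 = 0\<close>.\<close>
  have term_eq: "c n * (real n powr - \<sigma> * a n) = laguerre_term \<alpha> L x x n" if "n \<ge> 1" for n
  proof -
    have "real n powr (\<alpha> + 1) * real n powr - \<sigma> = real n powr - 2"
      by (simp add: \<sigma>_def flip: powr_add)
    also have "\<dots> = 1 / (real n)\<^sup>2" using that by (simp add: powr_minus divide_inverse)
    finally have "real n powr (\<alpha> + 1) * real n powr - \<sigma> * (real n)\<^sup>2 = 1" using that by simp
    moreover have "c n * (real n powr - \<sigma> * a n)
       = (real n powr (\<alpha> + 1) * real n powr - \<sigma> * (real n)\<^sup>2) * (Gamma (real n) * poly (laguerre \<alpha> n) x * poly (laguerre \<alpha> n) x / Gamma (real n + \<alpha> + 1))"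
      by (simp add: c_def a_def power_mult_distrib power2_eq_square)
    ultimately show ?thesis
      by (simp add: laguerre_term_def assoc_laguerre_polys_unique[OF \<alpha> L])
  qed
  have eq: "c (N + 1 + k) * (real (N + 1 + k) powr - \<sigma> * a (N + 1 + k)) = laguerre_term \<alpha> L x x (N + 1 + k)" for N k
    by (rule term_eq) simp
  have v0: "real n powr - \<sigma> * a n \<ge> 0" for n by (simp add: a0)
  have "summable (\<lambda>k. c (k + (N + 1)) * (real (k + (N + 1)) powr - \<sigma> * a (k + (N + 1))))"
    using W(1)[OF v0] by (subst summable_iff_shift)
  then show "summable (\<lambda>k. laguerre_term \<alpha> L x x (N + 1 + k))"
    by (simp only: add.commute[of _ "N + 1"] eq)
  have "(\<lambda>N. sqrt (real N) * (\<Sum>k. laguerre_term \<alpha> L x x (N + 1 + k))) \<longlonglongrightarrow>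
      1 * (C / Gamma (\<rho> + 1) * \<rho> / (\<sigma> - \<rho>))"
    using W(2)[OF v0] unfolding eq S .
  moreover have "1 * (C / Gamma (\<rho> + 1) * \<rho> / (\<sigma> - \<rho>)) = x powr (- \<alpha> - 1 / 2) * exp x / pi"
  proof -
    have "Gamma (\<rho> + 1) = \<rho> * Gamma \<rho>" using \<rho> by (intro Gamma_plus1) auto
    moreover have "Gamma \<rho> \<noteq> 0" using Gamma_real_pos[OF \<rho>(1)] by linarith
    ultimately show ?thesis using \<rho> unfolding \<sigma>\<rho> C_def by (simp add: field_simps)
  qed
  ultimately show "(\<lambda>N. sqrt (real N) * (\<Sum>k. laguerre_term \<alpha> L x x (N + 1 + k)))
              \<longlonglongrightarrow> x powr (- \<alpha> - 1 / 2) * exp x / pi" by simp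
qed

text \<open>
  The inequality \<open>2 |p q| \<le> p\<^sup>2 + q\<^sup>2\<close>, the weight being nonnegative for \<open>n \<ge> 1\<close>.
\<close>

lemma abs_laguerre_term_le:
  assumes "n \<ge> 1"
  shows "\<bar>laguerre_term \<alpha> L x y n\<bar> \<le> (laguerre_term \<alpha> L x x n + laguerre_term \<alpha> L y y n) / 2"
proof -
  define w where "w = Gamma (real n) / Gamma (real n + \<alpha> + 1)"
  have w: "w \<ge> 0" unfolding w_def using assms \<alpha> by (intro divide_nonneg_nonneg less_imp_le Gamma_real_pos) auto
  have t: "laguerre_term \<alpha> L u v n = w * (poly (L n) u * poly (L n) v)" for u v
    by (simp add: laguerre_term_def w_def)
  have "\<bar>p * q\<bar> \<le> (p * p + q * q) / 2" for p q :: real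
  proof -
    have "0 \<le> (\<bar>p\<bar> - \<bar>q\<bar>)\<^sup>2" by simp
    also have "(\<bar>p\<bar> - \<bar>q\<bar>)\<^sup>2 = p * p + q * q - 2 * \<bar>p * q\<bar>"
      by (simp add: power2_diff abs_mult) (simp add: power2_eq_square)
    finally show ?thesis by simp
  qed
  from mult_left_mono[OF this w] show ?thesis
    unfolding t using w by (simp add: abs_mult ring_distribs)
qed

text \<open>
  The bound by the two diagonal tails is of order \<open>1 / sqrt N\<close>, and \<open>\<gamma> - 1/2\<close> is negative.
\<close>

lemma laguerre_term_off_diagonal:
  assumes x: "x > 0" and y: "y > 0"
  shows "summable (\<lambda>k. laguerre_term \<alpha> L x y (N + 1 + k))"
    and "\<gamma> < 1 / 2 \<Longrightarrow> (\<lambda>N. real N powr \<gamma> * (\<Sum>k. laguerre_term \<alpha> L x y (N + 1 + k))) \<longlonglongrightarrow> 0"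
proof -
  define T where "T u v N = (\<Sum>k. laguerre_term \<alpha> L u v (N + 1 + k))" for u v N
  note sx = laguerre_term_diagonal(1)[OF x] and sy = laguerre_term_diagonal(1)[OF y]
  have le: "norm (laguerre_term \<alpha> L x y (N + 1 + k))
      \<le> (laguerre_term \<alpha> L x x (N + 1 + k) + laguerre_term \<alpha> L y y (N + 1 + k)) / 2" for N k
    using abs_laguerre_term_le[of "N + 1 + k" x y] by simp
  have sm: "summable (\<lambda>k. (laguerre_term \<alpha> L x x (N + 1 + k) + laguerre_term \<alpha> L y y (N + 1 + k)) / 2)" for N
    by (intro summable_divide summable_add sx sy)
  show "summable (\<lambda>k. laguerre_term \<alpha> L x y (N + 1 + k))"
    by (rule summable_comparison_test'[OF sm le])
  have bound: "\<bar>T x y N\<bar> \<le> (T x x N + T y y N) / 2" for N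
    using norm_suminf_le[OF le sm[of N]] 
    unfolding T_def by (simp only: suminf_divide[OF summable_add[OF sx sy]] suminf_add[OF sx sy] real_norm_def)
  assume \<gamma>: "\<gamma> < 1 / 2"
  have p0: "(\<lambda>N. real N powr (\<gamma> - 1 / 2)) \<longlonglongrightarrow> 0"
    using \<gamma> by real_asymp
  have "(\<lambda>N. real N powr (\<gamma> - 1 / 2) * ((sqrt (real N) * T x x N + sqrt (real N) * T y y N) / 2)) \<longlonglongrightarrow>
      0 * ((x powr (- \<alpha> - 1 / 2) * exp x / pi + y powr (- \<alpha> - 1 / 2) * exp y / pi) / 2)"
    unfolding T_def
    by (intro tendsto_mult tendsto_divide tendsto_add tendsto_const p0 laguerre_term_diagonal(2) x y) auto
  then have lim: "(\<lambda>N. real N powr (\<gamma> - 1 / 2) * ((sqrt (real N) * T x x N + sqrt (real N) * T y y N) / 2)) \<longlonglongrightarrow> 0"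
    by simp
  show "(\<lambda>N. real N powr \<gamma> * (\<Sum>k. laguerre_term \<alpha> L x y (N + 1 + k))) \<longlonglongrightarrow> 0"
  proof (rule Lim_null_comparison[OF always_eventually lim], rule allI)
    fix N
    have "real N powr (\<gamma> - 1 / 2) * sqrt (real N) = real N powr \<gamma>"
      by (simp add: powr_half_sqrt[symmetric] flip: powr_add)
    then have "real N powr (\<gamma> - 1 / 2) * ((sqrt (real N) * T x x N + sqrt (real N) * T y y N) / 2)
        = real N powr \<gamma> * ((T x x N + T y y N) / 2)"
      by (simp add: distrib_left flip: mult.assoc)
    then show "norm (real N powr \<gamma> * (\<Sum>k. laguerre_term \<alpha> L x y (N + 1 + k)))
        \<le> real N powr (\<gamma> - 1 / 2) * ((sqrt (real N) * T x x N + sqrt (real N) * T y y N) / 2)"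
      using mult_left_mono[OF bound[of N] powr_ge_zero[of "real N" \<gamma>]] by (simp add: abs_mult T_def)
  qed
qed

end

theorem theorem1p4:
  fixes \<alpha> :: real and L :: "nat \<Rightarrow> real poly"
  assumes "\<alpha> > - 1" and "assoc_laguerre_polys \<alpha> L"
  shows "(\<forall>x>0.
            (\<forall>N. summable (\<lambda>k. laguerre_term \<alpha> L x x (N + 1 + k))) \<and>
            (\<lambda>N. sqrt (real N) * (\<Sum>k. laguerre_term \<alpha> L x x (N + 1 + k)))
              \<longlonglongrightarrow> x powr (- \<alpha> - 1 / 2) * exp x / pi) \<and>
         (\<forall>x>0. \<forall>y>0. x \<noteq> y \<longrightarrow>
            (\<forall>N. summable (\<lambda>k. laguerre_term \<alpha> L x y (N + 1 + k))) \<and>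
            (\<forall>\<gamma><1/2. (\<lambda>N. real N powr \<gamma> * (\<Sum>k. laguerre_term \<alpha> L x y (N + 1 + k)))
              \<longlonglongrightarrow> 0))"
  by (intro conjI allI impI laguerre_term_diagonal[OF assms] laguerre_term_off_diagonal[OF assms])

end
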